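(* (i) Let $w\ge 1$, $l\ge 1$ be integers with $wl\ge 2$ and $(w,l)\notin\{(1,4),(1,6)\}$. Then $\lambda_k^c(\overleftrightarrow{K}_{[w]^l})=w(l-1)$ for every $2\le k\le wl$. (ii) Let $2\le t<z$ be integers. Then $\lambda_k^c(\overleftrightarrow{K}_{t,z})=t$ for $2\le k\le t$, and $\lambda_k^c(\overleftrightarrow{K}_{t,z})=0$ for $t+1\le k\le t+z$.
   Context: $\overleftrightarrow{K}_{[w]^l}$ denotes the complete multipartite regular digraph with $l$ parts each of size $w$: its vertex set is partitioned into $l$ sets of size $w$, and $xy$ is an arc iff $x$ and $y$ lie in different parts. $\overleftrightarrow{K}_{t,z}$ denotes the complete bipartite digraph with parts $X$, $Y$ of sizes $t$, $z$, having arcs $xy$ and $yx$ for all $x\in X$, $y\in Y$ and no other arcs. For a digraph $D$ and $S\subseteq V(D)$ with $|S|\ge 2$, a directed cycle $C$ of $D$ is an $S$-cycle if $S\subseteq V(C)$; two $S$-cycles are arc-disjoint if they share no arc; $\lambda_S^c(D)$ is the maximum number of pairwise arc-disjoint $S$-cycles in $D$. For $2\le k\le |V(D)|$, $\lambda_k^c(D)=\min\{\lambda_S^c(D): S\subseteq V(D), |S|=k\}$. *)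

theory Defs
  imports Main
begin

definition cycle_arcs :: "'a list \<Rightarrow> ('a \<times> 'a) set" where
  "cycle_arcs xs = {(xs ! i, xs ! ((i + 1) mod length xs)) | i. i < length xs}"

definition is_dcycle :: "'a set \<Rightarrow> ('a \<times> 'a) set \<Rightarrow> 'a list \<Rightarrow> bool" where
  "is_dcycle V A xs \<longleftrightarrow> length xs \<ge> 2 \<and> distinct xs \<and> set xs \<subseteq> V \<and> cycle_arcs xs \<subseteq> A"

definition is_S_cycle :: "'a set \<Rightarrow> ('a \<times> 'a) set \<Rightarrow> 'a set \<Rightarrow> 'a list \<Rightarrow> bool" where
  "is_S_cycle V A S xs \<longleftrightarrow> is_dcycle V A xs \<and> S \<subseteq> set xs"

definition lambda_S :: "'a set \<Rightarrow> ('a \<times> 'a) set \<Rightarrow> 'a set \<Rightarrow> nat" where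
  "lambda_S V A S = Max {length cs | cs. (\<forall>c\<in>set cs. is_S_cycle V A S c) \<and>
      (\<forall>i j. i < length cs \<and> j < length cs \<and> i \<noteq> j \<longrightarrow>
          cycle_arcs (cs ! i) \<inter> cycle_arcs (cs ! j) = {})}"

definition lambda_k :: "'a set \<Rightarrow> ('a \<times> 'a) set \<Rightarrow> nat \<Rightarrow> nat" where
  "lambda_k V A k = Min {lambda_S V A S | S. S \<subseteq> V \<and> card S = k}"

text \<open>Complete multipartite regular digraph with l parts of size w:
  vertex (i, p) is the i-th vertex of part p.\<close>
definition Kmp_V :: "nat \<Rightarrow> nat \<Rightarrow> (nat \<times> nat) set" where
  "Kmp_V w l = {0..<w} \<times> {0..<l}"

definition Kmp_A :: "nat \<Rightarrow> nat \<Rightarrow> ((nat \<times> nat) \<times> (nat \<times> nat)) set" where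
  "Kmp_A w l = {(x, y). x \<in> Kmp_V w l \<and> y \<in> Kmp_V w l \<and> snd x \<noteq> snd y}"

definition Kbip_V :: "nat \<Rightarrow> nat \<Rightarrow> (nat + nat) set" where
  "Kbip_V t z = Inl ` {0..<t} \<union> Inr ` {0..<z}"

definition Kbip_A :: "nat \<Rightarrow> nat \<Rightarrow> ((nat + nat) \<times> (nat + nat)) set" where
  "Kbip_A t z = {(Inl i, Inr j) | i j. i < t \<and> j < z} \<union> {(Inr j, Inl i) | i j. i < t \<and> j < z}"

end

theory Submission
  imports Defs
begin

text \<open>
  The upper bounds compare out-degrees: pairwise arc-disjoint cycles through a vertex v leave v by
  distinct arcs. Conversely, a decomposition of the digraph into Hamiltonian cycles serves all sets S
  at once, so everything rests on decomposing the complete multipartite digraph with l parts of size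
  w into w(l - 1) Hamiltonian cycles.

  Replacing each vertex by u independent copies turns a Hamiltonian cycle of length N into u of them,
  obtained as lifts along voltages in Z_u of net voltage 1; suitable voltages exist if N is even or u
  is odd. This reduces even w to w = 2, and odd w to w = 1 unless l is 4 or 6. For w = 2, and for
  w = 1 with l odd, the undirected zigzag cycles of Walecki, traversed in both directions, suffice.

  For w = 1 and l = 2N + 2 even and at least 8 (Tillson's theorem), all but five of the 1-factors
  "x + y is constant mod 2N + 1" are paired into zigzag cycles. The other five form a band graph,
  whose arcs are partitioned into five directed Hamiltonian cycles by induction: cutting the band
  near its end and inserting two layers replaces every arc across the cut by a path through new
  vertices, and the new arcs meet the cut in exactly the old pattern.

  For l = 4 or 6 and odd w at least 3, no decomposition invariant under Z_w is available for l = 4.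
  Instead l - 1 cycles run through w rows, each covering a row by a Hamiltonian path of K_l and
  moving on to the next row by one of l - 1 special arcs. There are two ways to match path ends with
  path starts, permuting the l - 1 paths by a 3-cycle and by a transposition respectively, so three
  uses of the first and an even number of uses of the second close the cycles up for every odd w.
  All remaining arcs are covered by Z_w-invariant cycles.
\<close>

section \<open>Hamiltonian cycles and packings\<close>

text \<open>Recording the arc set instead of the vertex list identifies all rotations of a cycle and
  turns arc-disjointness into disjointness of sets.\<close>

definition ham_cycle :: "'a set \<Rightarrow> ('a \<times> 'a) set \<Rightarrow> bool" where
  "ham_cycle V C \<longleftrightarrow>
    (\<exists>xs. length xs \<ge> 2 \<and> distinct xs \<and> set xs = V \<and> C = cycle_arcs xs)"

definition ham_packing :: "'a set \<Rightarrow> ('a \<times> 'a) set \<Rightarrow> nat \<Rightarrow> bool" where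
  "ham_packing V A m \<longleftrightarrow>
    (\<exists>F. finite F \<and> card F = m \<and> (\<forall>C\<in>F. ham_cycle V C \<and> C \<subseteq> A) \<and> pairwise disjnt F)"

text \<open>A walk with \<open>g N = g 0\<close> trades index arithmetic modulo the length for a
  single closing condition; cycles are handled in this form below.\<close>

lemma cycle_arcs_map_upt:
  assumes "g N = g 0"
  shows "cycle_arcs (map g [0..<N]) = (\<lambda>t. (g t, g (Suc t))) ` {..<N}"
proof -
  have "g (Suc i mod N) = g (Suc i)" if "i < N" for i
    using that assms by (cases "Suc i = N") auto
  then show ?thesis
    unfolding cycle_arcs_def by (force simp: image_iff)
qed

lemma ham_cycleI:
  assumes "N \<ge> 2" "inj_on g {..<N}" "g N = g 0" "g ` {..<N} = V"
    and "C = (\<lambda>t. (g t, g (Suc t))) ` {..<N}"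
  shows "ham_cycle V C"
  unfolding ham_cycle_def
  by (rule exI[of _ "map g [0..<N]"])
    (use assms in \<open>auto simp: cycle_arcs_map_upt distinct_map atLeast0LessThan\<close>)

lemma ham_cycleE:
  assumes "ham_cycle V C"
  obtains g N where "N \<ge> 2" "inj_on g {..<N}" "g N = g 0" "g ` {..<N} = V"
    "C = (\<lambda>t. (g t, g (Suc t))) ` {..<N}"
proof -
  obtain xs where xs: "length xs \<ge> 2" "distinct xs" "set xs = V" "C = cycle_arcs xs"
    using assms unfolding ham_cycle_def by blast
  let ?N = "length xs"
  let ?g = "\<lambda>t. xs ! (t mod ?N)"
  have inj: "inj_on ?g {..<?N}"
    using xs by (auto simp: inj_on_def nth_eq_iff_index_eq)
  have img: "?g ` {..<?N} = V"
    using xs(3) by (force simp: in_set_conv_nth image_iff)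
  have eq: "map ?g [0..<?N] = xs"
    by (rule nth_equalityI) auto
  show ?thesis
    using that[of ?N ?g] xs inj img cycle_arcs_map_upt[of ?g ?N] eq by simp
qed

lemma ham_cycle_nonempty: "ham_cycle V C \<Longrightarrow> C \<noteq> {}"
  by (erule ham_cycleE) (auto simp: lessThan_empty_iff)

lemma ham_cycle_vertices:
  assumes "ham_cycle V C"
  shows "C \<subseteq> V \<times> V"
proof -
  obtain g N where g: "N \<ge> 2" "inj_on g {..<N}" "g N = g 0" "g ` {..<N} = V"
    "C = (\<lambda>t. (g t, g (Suc t))) ` {..<N}"
    by (rule ham_cycleE[OF assms])
  have "g (Suc t) \<in> V" if "t < N" for t
    using that g(1,3,4) by (cases "Suc t = N") auto
  then show ?thesis using g(4,5) by auto
qed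

lemma ham_cycle_out:
  assumes "ham_cycle V C" "v \<in> V"
  shows "\<exists>y. (v, y) \<in> C"
  using assms by (elim ham_cycleE) auto

lemma ham_cycle_map:
  assumes "ham_cycle V C" "inj_on f V"
  shows "ham_cycle (f ` V) (map_prod f f ` C)"
proof -
  obtain g N where g: "N \<ge> 2" "inj_on g {..<N}" "g N = g 0" "g ` {..<N} = V"
    "C = (\<lambda>t. (g t, g (Suc t))) ` {..<N}"
    by (rule ham_cycleE[OF assms(1)])
  show ?thesis
  proof (rule ham_cycleI[of N "f \<circ> g"])
    show "inj_on (f \<circ> g) {..<N}" using g(2,4) assms(2) comp_inj_on by metis
    show "(f \<circ> g) ` {..<N} = f ` V" using g(4) by (simp only: image_comp [symmetric])
    show "map_prod f f ` C = (\<lambda>t. ((f \<circ> g) t, (f \<circ> g) (Suc t))) ` {..<N}"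
      unfolding g(5) image_image by simp
  qed (use g in simp_all)
qed

lemma ham_cycle_reverse:
  assumes "ham_cycle V C"
  shows "ham_cycle V (C\<inverse>)"
proof -
  obtain g N where g: "N \<ge> 2" "inj_on g {..<N}" "g N = g 0" "g ` {..<N} = V"
    "C = (\<lambda>t. (g t, g (Suc t))) ` {..<N}"
    by (rule ham_cycleE[OF assms])
  have surj: "(\<lambda>t. N - Suc t) ` {..<N} = {..<N}"
    by (rule endo_inj_surj) (auto simp: inj_on_def)
  let ?h = "\<lambda>t. g (if t = 0 then N else N - t)"
  \<comment> \<open>For \<open>t < N\<close> this form of the index stays in the range where
    \<open>g\<close> is injective.\<close>
  have h: "?h t = g (if t = 0 then 0 else N - t)" for t
    using g(3) by simp
  have 1: "inj_on ?h {..<N}"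
  proof (rule inj_onI)
    fix x y assume xy: "x \<in> {..<N}" "y \<in> {..<N}" "?h x = ?h y"
    have "(if x = 0 then 0 else N - x) = (if y = 0 then 0 else N - y)"
      by (rule inj_onD[OF g(2)]) (use xy g(1) in \<open>auto simp: h\<close>)
    then show "x = y" using xy by (auto split: if_splits)
  qed
  have 2: "?h ` {..<N} = V"
  proof -
    have "?h ` {..<N} \<subseteq> V"
    proof
      fix v assume "v \<in> ?h ` {..<N}"
      then obtain t where "t < N" "v = ?h t" by auto
      then show "v \<in> V" using g(3,4) by (cases "t = 0") auto
    qed
    moreover have "card (?h ` {..<N}) = card V"
      using 1 g(2,4) by (metis card_image)
    moreover have "finite V" using g(4) by auto
    ultimately show ?thesis by (simp add: card_subset_eq)
  qed
  have 3: "C\<inverse> = (\<lambda>t. (?h t, ?h (Suc t))) ` {..<N}"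
  proof -
    have "C\<inverse> = (\<lambda>t. (g (Suc t), g t)) ` {..<N}"
      using g(5) by auto
    also have "\<dots> = (\<lambda>t. (g (Suc t), g t)) ` (\<lambda>t. N - Suc t) ` {..<N}"
      by (simp add: surj)
    also have "\<dots> = (\<lambda>t. (?h t, ?h (Suc t))) ` {..<N}"
      unfolding image_image by (rule image_cong) (auto simp: Suc_diff_Suc)
    finally show ?thesis .
  qed
  show ?thesis
  proof (rule ham_cycleI[of N ?h])
    show "?h N = ?h 0" using g(3) by simp
  qed (fact g(1) 1 2 3)+
qed

text \<open>If an arc and its reverse both occurred, each of two positions would be the successor of
  the other modulo the length, which forces length 2.\<close>

lemma ham_cycle_reverse_disjoint:
  assumes "ham_cycle V C" "card V \<ge> 3"
  shows "C \<inter> C\<inverse> = {}"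
proof (rule equals0I, clarify)
  fix x y assume xy: "(x, y) \<in> C" "(y, x) \<in> C"
  obtain g N where g: "N \<ge> 2" "inj_on g {..<N}" "g N = g 0" "g ` {..<N} = V"
    "C = (\<lambda>t. (g t, g (Suc t))) ` {..<N}"
    by (rule ham_cycleE[OF assms(1)])
  have N: "N = card V" using g(2,4) by (metis card_image card_lessThan)
  have m: "g (Suc t) = g (Suc t mod N)" if "t < N" for t
    using that g(3) by (cases "Suc t = N") auto
  obtain s t where st: "s < N" "t < N" "g s = g (Suc t mod N)" "g t = g (Suc s mod N)"
    using xy g(5) m by auto
  have e: "s = Suc t mod N" "t = Suc s mod N"
    by (rule inj_onD[OF g(2)]; use st in simp)+
  have "N \<ge> 3" using assms(2) N by simp
  have *: "Suc x = N \<and> Suc x mod N = 0 \<or> Suc x < N \<and> Suc x mod N = Suc x" if "x < N" for x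
    using that by (cases "Suc x = N") auto
  from *[OF st(2)] *[OF st(1)] have
    "(Suc t = N \<and> s = 0 \<or> s = Suc t) \<and> (Suc s = N \<and> t = 0 \<or> t = Suc s)"
    unfolding e[symmetric] by blast
  with \<open>N \<ge> 3\<close> show False by linarith
qed

lemma ham_packingI:
  assumes "finite I" "card I = m"
    and ham: "\<And>i. i \<in> I \<Longrightarrow> ham_cycle V (f i)"
    and sub: "\<And>i. i \<in> I \<Longrightarrow> f i \<subseteq> A"
    and disj: "\<And>i j. i \<in> I \<Longrightarrow> j \<in> I \<Longrightarrow> i \<noteq> j \<Longrightarrow> f i \<inter> f j = {}"
  shows "ham_packing V A m"
proof -
  \<comment> \<open>Two indices with the same cycle would make it disjoint from itself, hence empty;
    so \<open>m\<close> indices give \<open>m\<close> cycles.\<close>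
  have "inj_on f I"
  proof (rule inj_onI, rule ccontr)
    fix i j assume "i \<in> I" "j \<in> I" "f i = f j" "i \<noteq> j"
    then show False
      using disj[of i j] ham_cycle_nonempty[OF ham[of i]] by simp
  qed
  then have "card (f ` I) = m"
    using assms(2) card_image by blast
  then show ?thesis
    unfolding ham_packing_def
  proof (intro exI[of _ "f ` I"] conjI)
    show "pairwise disjnt (f ` I)"
      unfolding pairwise_def disjnt_def using disj by (metis imageE)
  qed (use assms in auto)
qed

lemma ham_packing_mono: "ham_packing V A m \<Longrightarrow> A \<subseteq> B \<Longrightarrow> ham_packing V B m"
  unfolding ham_packing_def by (metis subset_trans)

lemma ham_packing_Un:
  assumes "ham_packing V A m" "ham_packing V B n" "A \<inter> B = {}"
  shows "ham_packing V (A \<union> B) (m + n)"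
proof -
  obtain F where F: "finite F" "card F = m" "\<forall>C\<in>F. ham_cycle V C \<and> C \<subseteq> A" "pairwise disjnt F"
    using assms(1) unfolding ham_packing_def by blast
  obtain G where G: "finite G" "card G = n" "\<forall>C\<in>G. ham_cycle V C \<and> C \<subseteq> B" "pairwise disjnt G"
    using assms(2) unfolding ham_packing_def by blast
  have cross: "disjnt C D" if "C \<in> F" "D \<in> G" for C D
  proof -
    have "C \<subseteq> A" "D \<subseteq> B" using that F(3) G(3) by auto
    then show ?thesis using assms(3) unfolding disjnt_def by blast
  qed
  have "F \<inter> G = {}"
  proof (rule equals0I)
    fix C assume "C \<in> F \<inter> G"
    then have "ham_cycle V C" "disjnt C C" using cross[of C C] F(3) by blast+
    then show False using ham_cycle_nonempty[of V C] by (simp add: disjnt_def)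
  qed
  then have "card (F \<union> G) = m + n"
    using F G by (simp add: card_Un_disjoint)
  moreover have "pairwise disjnt (F \<union> G)"
    using F(4) G(4) cross unfolding pairwise_def by (metis Un_iff disjnt_sym)
  ultimately show ?thesis
    unfolding ham_packing_def
    using F(1,3) G(1,3) by (intro exI[of _ "F \<union> G"]) auto
qed

lemma ham_packing_map:
  assumes "ham_packing V A m" "inj_on f V" "f ` V = W"
    and "\<And>x y. (x, y) \<in> A \<Longrightarrow> x \<in> V \<Longrightarrow> y \<in> V \<Longrightarrow> (f x, f y) \<in> B"
  shows "ham_packing W B m"
proof -
  obtain F where F: "finite F" "card F = m" "\<forall>C\<in>F. ham_cycle V C \<and> C \<subseteq> A" "pairwise disjnt F"
    using assms(1) unfolding ham_packing_def by blast
  have FV: "C \<subseteq> V \<times> V" if "C \<in> F" for C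
    using that F(3) ham_cycle_vertices by blast
  show ?thesis
  proof (rule ham_packingI[of F _ _ "\<lambda>C. map_prod f f ` C"])
    show "ham_cycle W (map_prod f f ` C)" if "C \<in> F" for C
      using ham_cycle_map[OF _ assms(2)] that F(3) assms(3) by blast
    show "map_prod f f ` C \<subseteq> B" if "C \<in> F" for C
      using that F(3) FV[OF that] assms(4) by fastforce
    show "map_prod f f ` C \<inter> map_prod f f ` D = {}" if "C \<in> F" "D \<in> F" "C \<noteq> D" for C D
    proof -
      have "inj_on (map_prod f f) (V \<times> V)"
        using assms(2) by (rule map_prod_inj_on) (rule assms(2))
      moreover have "C \<inter> D = {}"
        using F(4) that by (auto simp: pairwise_def disjnt_def)
      ultimately show ?thesis
        using FV[OF that(1)] FV[OF that(2)]
        by (metis (no_types, lifting) image_empty inj_on_image_Int)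
    qed
  qed (use F in auto)
qed

text \<open>The boolean index selects the direction of traversal, so \<open>m\<close> edge-disjoint
  undirected cycles give twice as many directed ones.\<close>

lemma ham_packing_reverse_closed:
  assumes "finite I" "card I = m" "card V \<ge> 3"
    and ham: "\<And>i. i \<in> I \<Longrightarrow> ham_cycle V (f i)"
    and sub: "\<And>i. i \<in> I \<Longrightarrow> f i \<union> (f i)\<inverse> \<subseteq> A"
    and disj: "\<And>i j. i \<in> I \<Longrightarrow> j \<in> I \<Longrightarrow> i \<noteq> j \<Longrightarrow>
      (f i \<union> (f i)\<inverse>) \<inter> (f j \<union> (f j)\<inverse>) = {}"
  shows "ham_packing V A (2 * m)"
proof (rule ham_packingI[of "I \<times> (UNIV :: bool set)" _ _ "\<lambda>(i, b). if b then f i else (f i)\<inverse>"])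
  show "card (I \<times> (UNIV :: bool set)) = 2 * m"
    using assms(2) by (simp add: card_cartesian_product)
  show "(case i of (i, b) \<Rightarrow> if b then f i else (f i)\<inverse>) \<inter>
      (case j of (i, b) \<Rightarrow> if b then f i else (f i)\<inverse>) = {}"
    if "i \<in> I \<times> UNIV" "j \<in> I \<times> UNIV" "i \<noteq> j" for i j
  proof -
    obtain a b c d where ij: "i = (a, b)" "j = (c, d)" by (cases i, cases j)
    show ?thesis
    proof (cases "a = c")
      case True
      then have "b \<noteq> d" using that ij by auto
      then show ?thesis
        using True ij ham_cycle_reverse_disjoint[OF ham[of a] assms(3)] that by auto
    next
      case False
      then have "(f a \<union> (f a)\<inverse>) \<inter> (f c \<union> (f c)\<inverse>) = {}"
        using that ij disj[of a c] by auto
      then show ?thesis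
        using ij by (simp split: if_splits) blast
    qed
  qed
  show "ham_cycle V (case i of (i, b) \<Rightarrow> if b then f i else (f i)\<inverse>)" if "i \<in> I \<times> UNIV" for i
    using that ham ham_cycle_reverse by (cases i) auto
  show "(case i of (i, b) \<Rightarrow> if b then f i else (f i)\<inverse>) \<subseteq> A" if "i \<in> I \<times> UNIV" for i
    using that sub by (cases i) auto
qed (use assms(1) in simp)

section \<open>Lifts along voltages and blow-ups\<close>

lemma mult_mod_eq_imp_eq:
  fixes q q' :: nat and K x :: int
  assumes "coprime K (int u)" "q < u" "q' < u"
    and "(x + int q * K) mod int u = (x + int q' * K) mod int u"
  shows "q = q'"
proof -
  have "int u dvd (x + int q * K) - (x + int q' * K)"
    using assms(4) by (simp add: mod_eq_dvd_iff)
  also have "(x + int q * K) - (x + int q' * K) = (int q - int q') * K"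
    by (simp add: algebra_simps)
  finally have "int u dvd int q - int q'"
    using assms(1) coprime_commute coprime_dvd_mult_left_iff by blast
  then have "int q mod int u = int q' mod int u"
    by (simp add: mod_eq_dvd_iff)
  then show ?thesis using assms(2,3) by simp
qed

text \<open>Each turn around the base cycle shifts the second coordinate by the net voltage. As that
  is a unit modulo \<open>u\<close>, the walk closes only after \<open>u\<close> turns, when it has
  met every copy of every vertex.\<close>

lemma ham_cycle_lift:
  fixes v :: "nat \<Rightarrow> int" and u :: nat
  assumes "N \<ge> 2" "inj_on g {..<N}" "g N = g 0" "u \<ge> 1"
    and cop: "coprime (\<Sum>r<N. v r) (int u)"
  shows "ham_cycle (g ` {..<N} \<times> {0..<int u})
    {((g r, a), (g (Suc r), (a + v r) mod int u)) | r a. r < N \<and> a \<in> {0..<int u}}"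
proof -
  define \<sigma> where "\<sigma> r = (\<Sum>i<r. v i)" for r
  define K where "K = \<sigma> N"
  \<comment> \<open>After \<open>s\<close> steps there are \<open>s div N\<close> full turns, each
    adding \<open>K\<close>, and a partial turn adding \<open>\<sigma> (s mod N)\<close>.\<close>
  define G where "G s = (g (s mod N), (\<sigma> (s mod N) + int (s div N) * K) mod int u)" for s
  let ?C = "{((g r, a), (g (Suc r), (a + v r) mod int u)) | r a. r < N \<and> a \<in> {0..<int u}}"
  have div: "s div N < u" if "s < N * u" for s
    using that assms(1) by (simp add: less_mult_imp_div_less mult.commute)
  have inj: "inj_on G {..<N * u}"
  proof (rule inj_onI)
    fix s t assume st: "s \<in> {..<N * u}" "t \<in> {..<N * u}" "G s = G t"
    then have r: "s mod N = t mod N"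
      using assms(1) by (auto simp: G_def intro: inj_onD[OF assms(2)])
    moreover have "s div N = t div N"
      using mult_mod_eq_imp_eq[of K u "s div N" "t div N" "\<sigma> (s mod N)"] cop div st r
      by (auto simp: G_def K_def \<sigma>_def)
    ultimately show "s = t" by (metis div_mult_mod_eq)
  qed
  have "G ` {..<N * u} \<subseteq> g ` {..<N} \<times> {0..<int u}"
    using assms(1,4) by (auto simp: G_def)
  moreover have "card (G ` {..<N * u}) = card (g ` {..<N} \<times> {0..<int u})"
    using assms(2) inj by (simp add: card_image card_cartesian_product)
  ultimately have img: "G ` {..<N * u} = g ` {..<N} \<times> {0..<int u}"
    by (intro card_subset_eq) auto
  have step: "(G s, G (Suc s)) = ((g r, a), (g (Suc r), (a + v r) mod int u))"
    if "r = s mod N" "a = snd (G s)" for s r a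
  proof (cases "Suc r = N")
    case True
    then have q: "Suc s mod N = 0" "Suc s div N = Suc (s div N)"
      using that(1) assms(1) by (auto simp: mod_Suc div_Suc)
    \<comment> \<open>The last voltage completes the partial sum to \<open>K\<close>, which the
      increased turn count then accounts for.\<close>
    have "K = \<sigma> r + v r"
      using True by (auto simp: K_def \<sigma>_def)
    then have "(int (Suc (s div N)) * K) mod int u = (\<sigma> r + int (s div N) * K + v r) mod int u"
      by (simp add: algebra_simps)
    then show ?thesis
      using that True q assms(3) by (simp add: G_def \<sigma>_def mod_add_left_eq)
  next
    case False
    then have q: "Suc s mod N = Suc r" "Suc s div N = s div N"
      using that(1) assms(1) by (auto simp: mod_Suc div_Suc)
    have "(\<sigma> (Suc r) + int (s div N) * K) mod int u = (\<sigma> r + int (s div N) * K + v r) mod int u"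
      by (simp add: \<sigma>_def algebra_simps)
    then show ?thesis
      using that q by (simp add: G_def mod_add_left_eq)
  qed
  have "?C = (\<lambda>s. (G s, G (Suc s))) ` {..<N * u}"
  proof (intro equalityI subsetI)
    fix e assume "e \<in> ?C"
    then obtain r a where e: "e = ((g r, a), (g (Suc r), (a + v r) mod int u))" "r < N" "a \<in> {0..<int u}"
      by blast
    then have "(g r, a) \<in> G ` {..<N * u}" unfolding img by auto
    then obtain s where s: "s < N * u" "G s = (g r, a)" by auto
    then have "s mod N = r"
      using e(2) by (auto simp: G_def intro: inj_onD[OF assms(2)])
    then have "e = (G s, G (Suc s))"
      unfolding e(1) by (intro step[symmetric]) (simp_all add: s(2))
    then show "e \<in> (\<lambda>s. (G s, G (Suc s))) ` {..<N * u}"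
      using s(1) by blast
  next
    fix e assume "e \<in> (\<lambda>s. (G s, G (Suc s))) ` {..<N * u}"
    then obtain s where s: "s < N * u" "e = (G s, G (Suc s))" by auto
    have "snd (G s) \<in> {0..<int u}" "s mod N < N"
      using assms(1,4) by (auto simp: G_def)
    then show "e \<in> ?C" using step[of "s mod N" s "snd (G s)"] s by blast
  qed
  moreover have "2 * 1 \<le> N * u"
    using assms(1,4) by (rule mult_le_mono)
  then have "N * u \<ge> 2" by simp
  moreover have "G (N * u) = G 0"
    using assms(1) by (simp add: G_def)
  ultimately show ?thesis
    using ham_cycleI[OF _ inj _ img] by blast
qed

text \<open>At each position the voltage determines the parameter \<open>c\<close>, which will keep
  the \<open>u\<close> lifts disjoint, yet \<open>c\<close> must cancel in the sum. For even
  \<open>N\<close> the signs alternate; for odd \<open>N\<close> the first three positions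
  contribute \<open>c\<close>, \<open>c\<close> and \<open>- 2 * c\<close>, and 2 is invertible
  because \<open>u\<close> is odd.\<close>

lemma blow_up_voltages:
  assumes "N \<ge> 2" "even N \<or> odd u"
  obtains v :: "int \<Rightarrow> nat \<Rightarrow> int" where "\<And>c. (\<Sum>r<N. v c r) = 1"
    and "\<And>c d r. c \<in> {0..<int u} \<Longrightarrow> d \<in> {0..<int u} \<Longrightarrow> v c r mod int u = v d r mod int u \<Longrightarrow> c = d"
proof (cases "even N")
  case True
  define v :: "int \<Rightarrow> nat \<Rightarrow> int"
    where "v c r = (if r = 0 then 1 + c else if even r then c else - c)" for c r
  have "(\<Sum>r<Suc n. v c r) = (if even n then 1 + c else 1)" for c n
    by (induction n) (auto simp: v_def)
  from this[of _ "N - 1"] have "(\<Sum>r<N. v c r) = 1" for c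
    using True assms(1) by simp
  moreover have "c = d"
    if cd: "c \<in> {0..<int u}" "d \<in> {0..<int u}" "v c r mod int u = v d r mod int u" for c d r
  proof -
    have "int u dvd v c r - v d r" using cd by (simp add: mod_eq_dvd_iff)
    moreover have "v c r - v d r = c - d \<or> v c r - v d r = - (c - d)"
      by (auto simp: v_def)
    ultimately have "int u dvd c - d" by (metis dvd_minus_iff)
    then have "c mod int u = d mod int u" by (simp add: mod_eq_dvd_iff)
    then show ?thesis using cd by simp
  qed
  ultimately show ?thesis by (rule that)
next
  case False
  define v :: "int \<Rightarrow> nat \<Rightarrow> int"
    where "v c r = (if r < 2 then c else if r = 2 then 1 - 2 * c else if odd r then c else - c)" for c r
  have "(\<Sum>r<3 + n. v c r) = (if even n then 1 else 1 + c)" for c n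
    by (induction n) (auto simp: v_def numeral_3_eq_3)
  from this[of _ "N - 3"] have "(\<Sum>r<N. v c r) = 1" for c
    using False assms(1) by (cases "N = 2") auto
  moreover have "c = d"
    if cd: "c \<in> {0..<int u}" "d \<in> {0..<int u}" "v c r mod int u = v d r mod int u" for c d r
  proof -
    have "int u dvd v c r - v d r" using cd by (simp add: mod_eq_dvd_iff)
    moreover have "v c r - v d r = c - d \<or> v c r - v d r = - (c - d) \<or> v c r - v d r = - (2 * (c - d))"
      by (auto simp: v_def)
    moreover have "coprime 2 (int u)" using False assms(2) by simp
    ultimately have "int u dvd c - d"
      by (metis coprime_commute coprime_dvd_mult_right_iff dvd_minus_iff)
    then have "c mod int u = d mod int u" by (simp add: mod_eq_dvd_iff)
    then show ?thesis using cd by simp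
  qed
  ultimately show ?thesis by (rule that)
qed

text \<open>A common arc of two lifts projects to a common arc of the base cycles, so these agree;
  the position agrees by injectivity, hence the voltages agree and with them the parameters.\<close>

lemma ham_packing_blow_up:
  assumes "ham_packing V A m" "card V \<ge> 2" "u \<ge> 1" "even (card V) \<or> odd u"
  shows "ham_packing (V \<times> {0..<int u})
    {(x, y). (fst x, fst y) \<in> A \<and> snd x \<in> {0..<int u} \<and> snd y \<in> {0..<int u}} (m * u)"
proof -
  define N where "N = card V"
  obtain F where F: "finite F" "card F = m" "\<forall>C\<in>F. ham_cycle V C \<and> C \<subseteq> A" "pairwise disjnt F"
    using assms(1) unfolding ham_packing_def by blast
  obtain v :: "int \<Rightarrow> nat \<Rightarrow> int" where v: "\<And>c. (\<Sum>r<N. v c r) = 1"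
    "\<And>c d r. c \<in> {0..<int u} \<Longrightarrow> d \<in> {0..<int u} \<Longrightarrow> v c r mod int u = v d r mod int u \<Longrightarrow> c = d"
    using blow_up_voltages[of N u] assms(2,4) N_def by metis
  have "\<exists>g. inj_on g {..<N} \<and> g N = g 0 \<and> g ` {..<N} = V \<and> C = (\<lambda>t. (g t, g (Suc t))) ` {..<N}"
    if "C \<in> F" for C
  proof -
    have "ham_cycle V C" using F(3) that by blast
    then obtain g n where g: "n \<ge> 2" "inj_on g {..<n}" "g n = g 0" "g ` {..<n} = V"
      "C = (\<lambda>t. (g t, g (Suc t))) ` {..<n}"
      by (rule ham_cycleE)
    have "n = N" using card_image[OF g(2)] g(4) N_def by simp
    then show ?thesis using g by blast
  qed
  then obtain g where g: "\<And>C. C \<in> F \<Longrightarrow> inj_on (g C) {..<N}" "\<And>C. C \<in> F \<Longrightarrow> g C N = g C 0"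
    "\<And>C. C \<in> F \<Longrightarrow> g C ` {..<N} = V" "\<And>C. C \<in> F \<Longrightarrow> C = (\<lambda>t. (g C t, g C (Suc t))) ` {..<N}"
    by metis
  define L where "L C c = {((g C r, a), (g C (Suc r), (a + v c r) mod int u)) | r a.
    r < N \<and> a \<in> {0..<int u}}" for C c
  have arc: "(g C r, g C (Suc r)) \<in> C" if "C \<in> F" "r < N" for C r
    using g(4)[OF that(1)] that(2) by blast
  show ?thesis
  proof (rule ham_packingI[of "F \<times> {0..<int u}" _ _ "\<lambda>(C, c). L C c"])
    show "finite (F \<times> {0..<int u})" "card (F \<times> {0..<int u}) = m * u"
      using F by (auto simp: card_cartesian_product)
    show "ham_cycle (V \<times> {0..<int u}) (case i of (C, c) \<Rightarrow> L C c)" if i_in: "i \<in> F \<times> {0..<int u}" for i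
    proof -
      obtain C c where i: "i = (C, c)" "C \<in> F" using i_in by blast
      show ?thesis
        using ham_cycle_lift[of N "g C" u "v c"] g[OF i(2)] v(1)[of c] assms(2,3) i(1)
        by (simp add: L_def N_def)
    qed
    show "(case i of (C, c) \<Rightarrow> L C c)
        \<subseteq> {(x, y). (fst x, fst y) \<in> A \<and> snd x \<in> {0..<int u} \<and> snd y \<in> {0..<int u}}"
      if "i \<in> F \<times> {0..<int u}" for i
      using that arc F(3) assms(3) by (force simp: L_def)
    show "(case i of (C, c) \<Rightarrow> L C c) \<inter> (case j of (C, c) \<Rightarrow> L C c) = {}"
      if ij: "i \<in> F \<times> {0..<int u}" "j \<in> F \<times> {0..<int u}" "i \<noteq> j" for i j
    proof (rule ccontr)
      obtain C c D d where i: "i = (C, c)" "j = (D, d)" by (cases i, cases j)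
      assume "(case i of (C, c) \<Rightarrow> L C c) \<inter> (case j of (C, c) \<Rightarrow> L C c) \<noteq> {}"
      then obtain e where "e \<in> L C c" "e \<in> L D d" using i by auto
      then obtain r a s where e: "r < N" "s < N" "g C r = g D s" "g C (Suc r) = g D (Suc s)"
        "(a + v c r) mod int u = (a + v d s) mod int u"
        unfolding L_def by auto
      have CD: "C \<in> F" "D \<in> F" "c \<in> {0..<int u}" "d \<in> {0..<int u}" using ij i by auto
      have "C = D"
        using arc[OF CD(1) e(1)] arc[OF CD(2) e(2)] e(3,4) F(4) CD(1,2)
        by (metis disjnt_iff pairwiseD)
      then have "r = s" using e g(1)[OF CD(1)] by (auto simp: inj_on_def)
      then have "v c r mod int u = v d r mod int u"
        using e(5) by (simp add: mod_eq_dvd_iff)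
      then show False using v(2) CD(3,4) ij(3) i \<open>C = D\<close> by blast
    qed
  qed
qed

section \<open>Five Hamiltonian cycles in the band graph\<close>

lemma ham_cycle_insert:
  assumes "ham_cycle V C" "(u, v) \<in> C" "p \<notin> V"
  shows "ham_cycle (insert p V) (C - {(u, v)} \<union> {(u, p), (p, v)})"
proof -
  obtain g N where g: "N \<ge> 2" "inj_on g {..<N}" "g N = g 0" "g ` {..<N} = V"
    "C = (\<lambda>t. (g t, g (Suc t))) ` {..<N}"
    by (rule ham_cycleE[OF assms(1)])
  obtain t where t: "t < N" "u = g t" "v = g (Suc t)"
    using assms(2) g(5) by auto
  define h where "h s = (if s \<le> t then g s else if s = Suc t then p else g (s - 1))" for s
  have split: "{..<Suc N} = {..t} \<union> {Suc t} \<union> Suc ` {Suc t..<N}"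
    using t(1) by (auto simp: image_iff)
  have split': "{..<N} = {..<t} \<union> {t} \<union> {Suc t..<N}"
    using t(1) by auto
  have img: "h ` {..<Suc N} = insert p V"
  proof -
    have "h ` {..<Suc N} = g ` {..t} \<union> {p} \<union> g ` {Suc t..<N}"
      unfolding split image_Un image_image by (auto simp: h_def)
    also have "\<dots> = insert p (g ` {..<N})"
      unfolding split' by (auto simp: le_less)
    finally show ?thesis using g(4) by simp
  qed
  \<comment> \<open>Injectivity comes from counting: the image has \<open>N + 1\<close>
    elements.\<close>
  have inj: "inj_on h {..<Suc N}"
  proof -
    have "card (h ` {..<Suc N}) = Suc (card V)"
      unfolding img using assms(3) g(4) by (subst card_insert_disjoint) auto
    also have "card V = N" using card_image[OF g(2)] g(4) by simp
    finally show ?thesis by (intro eq_card_imp_inj_on) auto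
  qed
  have arcs: "C - {(u, v)} \<union> {(u, p), (p, v)} = (\<lambda>s. (h s, h (Suc s))) ` {..<Suc N}"
  proof -
    let ?a = "\<lambda>s. (g s, g (Suc s))"
    have "inj_on ?a {..<N}"
      using g(2) by (auto simp: inj_on_def)
    from inj_on_image_set_diff[OF this, of "{..<N}" "{t}"]
    have "C - {(u, v)} = ?a ` ({..<N} - {t})"
      unfolding g(5) t(2,3) using t(1) by simp
    also have "{..<N} - {t} = {..<t} \<union> {Suc t..<N}"
      using t(1) by auto
    finally have 1: "C - {(u, v)} = ?a ` {..<t} \<union> ?a ` {Suc t..<N}"
      by (simp only: image_Un)
    have 2: "{..<Suc N} = {..<t} \<union> {t, Suc t} \<union> Suc ` {Suc t..<N}"
      unfolding split by auto
    have 3: "(\<lambda>s. (h s, h (Suc s))) ` {..<t} = ?a ` {..<t}"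
      by (rule image_cong) (auto simp: h_def)
    have 4: "(\<lambda>s. (h s, h (Suc s))) ` Suc ` {Suc t..<N} = ?a ` {Suc t..<N}"
      unfolding image_image by (rule image_cong) (auto simp: h_def)
    have 5: "(\<lambda>s. (h s, h (Suc s))) ` {t, Suc t} = {(u, p), (p, v)}"
      by (simp add: h_def t)
    show ?thesis
      unfolding 2 image_Un 3 4 5 1 by blast
  qed
  show ?thesis
    by (rule ham_cycleI[OF _ inj _ img arcs]) (use g t in \<open>auto simp: h_def\<close>)
qed

definition path_arcs :: "'a list \<Rightarrow> ('a \<times> 'a) set" where
  "path_arcs xs = set (zip xs (tl xs))"

lemma path_arcs_simps [simp]:
  "path_arcs [] = {}" "path_arcs [x] = {}"
  "path_arcs (x # y # xs) = insert (x, y) (path_arcs (y # xs))"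
  by (auto simp: path_arcs_def)

text \<open>Inner vertices of a detour will be new, so its arcs cannot be arcs of the old
  cycle.\<close>

lemma path_arcs_hit:
  "e \<in> path_arcs (u # ps @ [v]) \<Longrightarrow> ps \<noteq> [] \<Longrightarrow> fst e \<in> set ps \<or> snd e \<in> set ps"
proof (induction ps arbitrary: u)
  case (Cons p ps)
  then show ?case by (cases ps) auto
qed simp

lemma ham_cycle_detour:
  assumes "ham_cycle V C" "(u, v) \<in> C" "distinct ps" "set ps \<inter> V = {}" "ps \<noteq> []"
  shows "ham_cycle (V \<union> set ps) (C - {(u, v)} \<union> path_arcs (u # ps @ [v]))"
  using assms
proof (induction ps arbitrary: V C u)
  case (Cons p ps)
  have V: "C \<subseteq> V \<times> V" by (rule ham_cycle_vertices[OF Cons.prems(1)])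
  let ?C = "C - {(u, v)} \<union> {(u, p), (p, v)}"
  have 1: "ham_cycle (insert p V) ?C"
    using Cons.prems by (intro ham_cycle_insert) auto
  show ?case
  proof (cases "ps = []")
    case True
    then show ?thesis using 1 by (simp add: insert_commute)
  next
    case False
    have "ham_cycle (insert p V \<union> set ps) (?C - {(p, v)} \<union> path_arcs (p # ps @ [v]))"
      by (rule Cons.IH[OF 1]) (use Cons.prems False in auto)
    \<comment> \<open>Inserting \<open>p\<close> created the arc \<open>(p, v)\<close>, which the
      rest of the detour replaces; \<open>C\<close> itself lacks that arc because \<open>p\<close>
      is new.\<close>
    moreover have "?C - {(p, v)} = C - {(u, v)} \<union> {(u, p)}"
      using V Cons.prems(2,4) by auto
    ultimately show ?thesis by simp
  qed
qed simp

text \<open>The detours are carried out one after another: arcs still to be replaced survive, being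
  distinct from those already replaced, and arcs just inserted are not among them, since each meets
  a new vertex.\<close>

lemma ham_cycle_detours:
  assumes "ham_cycle V C"
    and "\<And>u ps v. (u, ps, v) \<in> set ds \<Longrightarrow> (u, v) \<in> C \<and> ps \<noteq> []"
    and "distinct (map (\<lambda>(u, ps, v). (u, v)) ds)"
    and "distinct (concat (map (\<lambda>(u, ps, v). ps) ds))"
    and "set (concat (map (\<lambda>(u, ps, v). ps) ds)) \<inter> V = {}"
  shows "ham_cycle (V \<union> set (concat (map (\<lambda>(u, ps, v). ps) ds)))
    (C - set (map (\<lambda>(u, ps, v). (u, v)) ds) \<union> (\<Union>(u, ps, v)\<in>set ds. path_arcs (u # ps @ [v])))"
  using assms
proof (induction ds arbitrary: V C)
  case (Cons d ds)
  obtain u ps v where d: "d = (u, ps, v)" by (cases d)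
  have V: "C \<subseteq> V \<times> V" by (rule ham_cycle_vertices[OF Cons.prems(1)])
  have uv: "(u, v) \<in> C" "ps \<noteq> []" using Cons.prems(2)[of u ps v] d by auto
  let ?P = "path_arcs (u # ps @ [v])"
  let ?C = "C - {(u, v)} \<union> ?P"
  let ?U = "set (map (\<lambda>(u, ps, v). (u, v)) ds)"
  have 1: "ham_cycle (V \<union> set ps) ?C"
    using Cons.prems(4,5) d uv by (intro ham_cycle_detour[OF Cons.prems(1)]) auto
  have U: "?U \<subseteq> C"
    using Cons.prems(2) by fastforce
  have 2: "?P \<inter> ?U = {}"
  proof (rule equals0I)
    fix e assume "e \<in> ?P \<inter> ?U"
    then have "e \<in> V \<times> V" "fst e \<in> set ps \<or> snd e \<in> set ps"
      using U V path_arcs_hit[of e u ps v] uv(2) by blast+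
    then show False using Cons.prems(5) d by auto
  qed
  let ?c = "concat (map (\<lambda>(u, ps, v). ps) ds)"
  have "distinct (ps @ ?c)" using Cons.prems(4) d by simp
  then have c: "distinct ?c" "set ps \<inter> set ?c = {}" by simp_all
  have "(set ps \<union> set ?c) \<inter> V = {}" using Cons.prems(5) d by simp
  then have cV: "set ?c \<inter> (V \<union> set ps) = {}" using c(2) by blast
  have "ham_cycle (V \<union> set ps \<union> set ?c)
    (?C - ?U \<union> (\<Union>(u, ps, v)\<in>set ds. path_arcs (u # ps @ [v])))"
  proof (rule Cons.IH[OF 1 _ _ c(1) cV])
    fix u' ps' v' assume "(u', ps', v') \<in> set ds"
    then show "(u', v') \<in> ?C \<and> ps' \<noteq> []"
      using Cons.prems(2)[of u' ps' v'] Cons.prems(3) d by force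
  qed (use Cons.prems(3) d in simp)
  moreover have "?C - ?U = C - insert (u, v) ?U \<union> ?P"
    using 2 by blast
  ultimately show ?case
    by (simp add: d Un_assoc)
qed simp

text \<open>
  Some x stands for the residue x + N + 1 modulo 2N + 1 and None for the point at infinity; the five
  1-factors are those with x + y congruent to -2, ..., 2.
\<close>
fun strip_adj :: "int \<Rightarrow> int option \<Rightarrow> int option \<Rightarrow> bool" where
  "strip_adj N (Some x) (Some y) \<longleftrightarrow> x \<noteq> y \<and> (\<bar>x + y\<bar> \<le> 2 \<or> \<bar>x + y\<bar> \<ge> 2 * N - 1)"
| "strip_adj N None (Some x) \<longleftrightarrow> \<bar>x\<bar> \<le> 1 \<or> \<bar>x\<bar> = N"
| "strip_adj N (Some x) None \<longleftrightarrow> \<bar>x\<bar> \<le> 1 \<or> \<bar>x\<bar> = N"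
| "strip_adj N None None \<longleftrightarrow> False"

definition strip_A :: "int \<Rightarrow> (int option \<times> int option) set" where
  "strip_A N = {(x, y). strip_adj N x y}"

definition strip_V :: "int \<Rightarrow> int option set" where
  "strip_V N = insert None (Some ` {-N..N})"

text \<open>The cut separates 0, 1, -1 from the outer vertices. Arcs at infinity do not count,
  because stretching respects adjacency to \<open>None\<close> on both sides.\<close>

definition crossing :: "(int option \<times> int option) set" where
  "crossing = {(Some x, Some y) | x y. (\<bar>x\<bar> \<le> 1) \<noteq> (\<bar>y\<bar> \<le> 1)}"

text \<open>
  Makes room for the layers 2 and 3 and swaps the two sides of the outer part. Without the swap the
  inserted paths would need an even number of inner vertices, since arcs inside the band join
  vertices of opposite sides, and the cycle crossing the cut four times could not afford that.
\<close>
definition stretch :: "int \<Rightarrow> int" where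
  "stretch x = (if x \<ge> 2 then - x - 2 else if x \<le> - 2 then - x + 2 else x)"

text \<open>All twelve arcs of the band graph across the cut, grouped by the cycle that uses them;
  for \<open>N \<ge> 3\<close> they do not depend on \<open>N\<close>.\<close>

definition cut_arcs :: "(int \<times> int) list list" where
  "cut_arcs =
    [[(0, -2), (-1, 2), (-3, 1), (3, -1)],
     [(1, -3), (2, 0)],
     [(-1, 3), (-2, 0)],
     [(0, 2), (-2, 1)],
     [(1, -2), (2, -1)]]"

text \<open>
  An entry (u, ps, v) replaces the stretched cut arc (u, v) by the path u, ps, v. The pattern was
  found by computer search; the point is that the new cut arcs of each cycle are again its old ones.
\<close>
definition cut_detours :: "(int \<times> int list \<times> int) list list" where
  "cut_detours =
    [[(0, [-2], 4), (-1, [2], -4), (5, [-3], 1), (-5, [3], -1)],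
     [(1, [-3], 5), (-4, [3, -2, 2], 0)],
     [(-1, [3], -5), (4, [-3, 2, -2], 0)],
     [(0, [2, -3, 3], -4), (4, [-2], 1)],
     [(1, [-2, 3, -3], 4), (-4, [2], -1)]]"

definition some_arc :: "int \<times> int \<Rightarrow> int option \<times> int option" where
  "some_arc = map_prod Some Some"

text \<open>The pattern at the cut belongs to the invariant because the induction step must know
  which arcs it reroutes in each cycle.\<close>

definition strip_state :: "int \<Rightarrow> (nat \<Rightarrow> (int option \<times> int option) set) \<Rightarrow> bool" where
  "strip_state N C \<longleftrightarrow>
    (\<forall>j<5. ham_cycle (strip_V N) (C j) \<and> C j \<subseteq> strip_A N \<and>
      C j \<inter> crossing = some_arc ` set (cut_arcs ! j)) \<and>
    (\<forall>i<5. \<forall>j<5. i \<noteq> j \<longrightarrow> C i \<inter> C j = {})"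

lemma less_5_cases: "(j::nat) < 5 \<longleftrightarrow> j = 0 \<or> j = 1 \<or> j = 2 \<or> j = 3 \<or> j = 4"
  by auto

lemma inj_stretch: "inj stretch"
  by (rule injI) (auto simp: stretch_def split: if_splits)

definition detour_arcs :: "nat \<Rightarrow> (int option \<times> int option) set" where
  "detour_arcs j =
    some_arc ` (\<Union>(u, ps, v)\<in>set (cut_detours ! j). path_arcs (u # ps @ [v]))"

text \<open>Index 1 is listed in both forms, \<open>1\<close> and \<open>Suc 0\<close>, so that the
  simplifier finds either.\<close>

lemma detour_arcs_eq:
  "detour_arcs 0 = some_arc ` {(0, -2), (-2, 4), (-1, 2), (2, -4), (5, -3), (-3, 1), (-5, 3), (3, -1)}"
  "detour_arcs 1 = some_arc ` {(1, -3), (-3, 5), (-4, 3), (3, -2), (-2, 2), (2, 0)}"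
  "detour_arcs (Suc 0) = some_arc ` {(1, -3), (-3, 5), (-4, 3), (3, -2), (-2, 2), (2, 0)}"
  "detour_arcs 2 = some_arc ` {(-1, 3), (3, -5), (4, -3), (-3, 2), (2, -2), (-2, 0)}"
  "detour_arcs 3 = some_arc ` {(0, 2), (2, -3), (-3, 3), (3, -4), (4, -2), (-2, 1)}"
  "detour_arcs 4 = some_arc ` {(1, -2), (-2, 3), (3, -3), (-3, 4), (-4, 2), (2, -1)}"
  by (auto simp: detour_arcs_def cut_detours_def)

text \<open>Between outer vertices on opposite sides the shifts cancel and the sum only changes
  sign. On the same side the sum is of the large kind, and its absolute value grows by 4, just as
  \<open>2 * N - 1\<close> does. Inner vertices stay fixed.\<close>

lemma strip_adj_stretch:
  assumes "strip_adj N x y" "(x, y) \<notin> crossing" "N \<ge> 3" "x \<in> strip_V N" "y \<in> strip_V N"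
  shows "strip_adj (N + 2) (map_option stretch x) (map_option stretch y)"
  using assms
  by (cases x; cases y) (auto simp: crossing_def stretch_def strip_V_def abs_if split: if_splits)

lemma strip_step:
  assumes "strip_state N C" "N \<ge> 3"
  shows "\<exists>C'. strip_state (N + 2) C'"
proof -
  have C: "\<And>j. j < 5 \<Longrightarrow> ham_cycle (strip_V N) (C j)" "\<And>j. j < 5 \<Longrightarrow> C j \<subseteq> strip_A N"
    "\<And>j. j < 5 \<Longrightarrow> C j \<inter> crossing = some_arc ` set (cut_arcs ! j)"
    "\<And>i j. i < 5 \<Longrightarrow> j < 5 \<Longrightarrow> i \<noteq> j \<Longrightarrow> C i \<inter> C j = {}"
    using assms(1) unfolding strip_state_def by auto
  define f where "f = map_option stretch"
  define D where "D j = map_prod f f ` C j" for j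
  have inj: "inj f" unfolding f_def using inj_stretch by (simp add: option.inj_map)
  \<comment> \<open>The stretched cut arcs are the only ones given up; all other arcs of the
    stretched cycles are arcs of the larger band graph.\<close>
  define old where "old j = some_arc ` (\<lambda>(u, ps, v). (u, v)) ` set (cut_detours ! j)" for j
  define C' where "C' j = D j - old j \<union> detour_arcs j" for j
  have old: "old j = map_prod f f ` some_arc ` set (cut_arcs ! j)" if "j < 5" for j
    using that unfolding less_5_cases
    by (elim disjE) (simp_all add: old_def some_arc_def cut_detours_def cut_arcs_def
        f_def stretch_def insert_commute)
  \<comment> \<open>Stretching vacates exactly the two new layers.\<close>
  have fV: "f ` strip_V N = strip_V (N + 2) - Some ` {-2, 2, -3, 3}"
  proof -
    have "stretch ` {-N..N} = {-(N+2)..N+2} - {-2, 2, -3, 3}"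
    proof (intro equalityI subsetI)
      fix y assume y: "y \<in> {-(N+2)..N+2} - {-2, 2, -3, 3}"
      then have "y = stretch (if y \<ge> 2 then - y + 2 else if y \<le> -2 then - y - 2 else y)"
        by (auto simp: stretch_def)
      moreover have "(if y \<ge> 2 then - y + 2 else if y \<le> -2 then - y - 2 else y) \<in> {-N..N}"
        using y assms(2) by auto
      ultimately show "y \<in> stretch ` {-N..N}" by (rule image_eqI)
    qed (auto simp: stretch_def split: if_splits)
    then have "Some ` stretch ` {-N..N} = Some ` ({-(N+2)..N+2} - {-2, 2, -3, 3})"
      by (rule arg_cong)
    then show ?thesis
      unfolding strip_V_def f_def image_insert image_image by (auto simp: image_iff)
  qed
  have D: "ham_cycle (f ` strip_V N) (D j)" if "j < 5" for j
    unfolding D_def by (rule ham_cycle_map[OF C(1)[OF that] inj_on_subset[OF inj subset_UNIV]])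
  have DV: "D j \<subseteq> f ` strip_V N \<times> f ` strip_V N" if "j < 5" for j
    by (rule ham_cycle_vertices[OF D[OF that]])
  have nonnew: "(Some x, y) \<notin> D j \<and> (y, Some x) \<notin> D j" if "j < 5" "x \<in> {-2, 2, -3, 3}" for j x y
    using DV[OF that(1)] that(2) unfolding fV by blast
  have ham: "ham_cycle (strip_V (N + 2)) (C' j)" if j: "j < 5" for j
  proof -
    let ?ds = "map (\<lambda>(u, ps, v). (Some u, map Some ps, Some v)) (cut_detours ! j)"
    let ?new = "set (concat (map (\<lambda>(u, ps, v). ps) ?ds))"
    have new: "?new = Some ` {-2, 2, -3, 3}"
      using j by (auto simp: less_5_cases cut_detours_def)
    have dist: "distinct (map (\<lambda>(u, ps, v). (u, v)) ?ds)"
      "distinct (concat (map (\<lambda>(u, ps, v). ps) ?ds))"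
      "\<forall>(u, ps, v)\<in>set ?ds. ps \<noteq> []"
      using j by (auto simp: less_5_cases cut_detours_def)
    have inD: "old j \<subseteq> D j"
      unfolding old[OF j] D_def C(3)[OF j, symmetric] by blast
    have olds: "set (map (\<lambda>(u, ps, v). (u, v)) ?ds) = old j"
      by (force simp: old_def some_arc_def)
    have news: "(\<Union>(u, ps, v)\<in>set ?ds. path_arcs (u # ps @ [v])) = detour_arcs j"
    proof -
      have "path_arcs (map Some xs) = some_arc ` path_arcs xs" for xs :: "int list"
        by (induction xs rule: induct_list012) (simp_all add: some_arc_def)
      then have *: "path_arcs (Some u # map Some ps @ [Some v]) = some_arc ` path_arcs (u # ps @ [v])"
        for u v :: int and ps by (metis list.simps(8) list.simps(9) map_append)
      show ?thesis
        by (simp add: detour_arcs_def * image_UN case_prod_unfold)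
    qed
    have "ham_cycle (f ` strip_V N \<union> ?new)
      (D j - set (map (\<lambda>(u, ps, v). (u, v)) ?ds) \<union> (\<Union>(u, ps, v)\<in>set ?ds. path_arcs (u # ps @ [v])))"
    proof (rule ham_cycle_detours[OF D[OF j] _ dist(1,2)])
      show "?new \<inter> f ` strip_V N = {}" unfolding new fV by blast
      show "(u, v) \<in> D j \<and> ps \<noteq> []" if "(u, ps, v) \<in> set ?ds" for u ps v
      proof
        have "(u, v) \<in> set (map (\<lambda>(u, ps, v). (u, v)) ?ds)"
          using that by force
        then show "(u, v) \<in> D j" using inD olds by blast
        show "ps \<noteq> []" using dist(3) that by blast
      qed
    qed
    moreover have "f ` strip_V N \<union> ?new = strip_V (N + 2)"
      unfolding new fV using assms(2) by (auto simp: strip_V_def)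
    ultimately show ?thesis
      unfolding C'_def olds news by simp
  qed
  have rest: "\<exists>x y. e = (f x, f y) \<and> (x, y) \<in> C j \<and> (x, y) \<notin> crossing"
    if e: "e \<in> D j - old j" and j: "j < 5" for e j
  proof -
    obtain x y where xy: "e = (f x, f y)" "(x, y) \<in> C j" using e unfolding D_def by auto
    have "(x, y) \<notin> crossing"
    proof
      assume "(x, y) \<in> crossing"
      then have "(x, y) \<in> some_arc ` set (cut_arcs ! j)" using C(3)[OF j] xy(2) by blast
      then show False using e old[OF j] xy(1) by (metis DiffD2 image_eqI map_prod_simp)
    qed
    then show ?thesis using xy by blast
  qed
  have sub: "C' j \<subseteq> strip_A (N + 2)" if j: "j < 5" for j
  proof -
    have "detour_arcs j \<subseteq> strip_A (N + 2)"
      using j by (auto simp: less_5_cases detour_arcs_eq some_arc_def strip_A_def)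
    moreover have "D j - old j \<subseteq> strip_A (N + 2)"
    proof
      fix e assume "e \<in> D j - old j"
      then obtain x y where xy: "e = (f x, f y)" "(x, y) \<in> C j" "(x, y) \<notin> crossing"
        using rest[OF _ j] by blast
      have "strip_adj N x y" "x \<in> strip_V N" "y \<in> strip_V N"
        using C(2)[OF j] xy(2) ham_cycle_vertices[OF C(1)[OF j]] by (auto simp: strip_A_def)
      then show "e \<in> strip_A (N + 2)"
        using strip_adj_stretch[OF _ xy(3) assms(2)] xy(1) by (simp add: strip_A_def f_def)
    qed
    ultimately show ?thesis unfolding C'_def by blast
  qed
  \<comment> \<open>Stretching preserves both sides of the cut, so the crossing arcs of the new
    cycles all come from the detours.\<close>
  have cross: "C' j \<inter> crossing = some_arc ` set (cut_arcs ! j)" if j: "j < 5" for j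
  proof -
    have "(D j - old j) \<inter> crossing = {}"
    proof (rule equals0I)
      fix e assume e: "e \<in> (D j - old j) \<inter> crossing"
      then obtain x y where "e = (f x, f y)" "(x, y) \<notin> crossing"
        using rest[OF _ j] by blast
      with e show False
        by (cases x; cases y) (auto simp: crossing_def f_def stretch_def split: if_splits)
    qed
    moreover have "detour_arcs j \<inter> crossing = some_arc ` set (cut_arcs ! j)"
      using j by (auto simp: less_5_cases detour_arcs_eq some_arc_def crossing_def cut_arcs_def)
    ultimately show ?thesis unfolding C'_def by blast
  qed
  \<comment> \<open>Every detour arc has an end in the new layers, which the stretched cycles
    avoid.\<close>
  have touch: "\<exists>x\<in>{-2, 2, -3, 3}. fst e = Some x \<or> snd e = Some x"
    if "e \<in> detour_arcs j" "j < 5" for e j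
    using that by (auto simp: less_5_cases detour_arcs_eq some_arc_def)
  have "C' i \<inter> C' j = {}" if ij: "i < 5" "j < 5" "i \<noteq> j" for i j
  proof -
    have 1: "D i \<inter> D j = {}"
      unfolding D_def using C(4)[OF ij] inj
      by (metis image_Int image_empty prod.inj_map)
    have 2: "D k \<inter> detour_arcs l = {}" if "k < 5" "l < 5" for k l
    proof (rule equals0I)
      fix e assume e: "e \<in> D k \<inter> detour_arcs l"
      then obtain x where "x \<in> {-2, 2, -3, 3}" "fst e = Some x \<or> snd e = Some x"
        using touch[of e l] \<open>l < 5\<close> by blast
      then show False using nonnew[OF \<open>k < 5\<close>, of x] e by (cases e) auto
    qed
    have 3: "detour_arcs i \<inter> detour_arcs j = {}"
      using ij unfolding less_5_cases
      by (elim disjE) (simp_all add: detour_arcs_eq some_arc_def)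
    show ?thesis
      using 1 2[OF ij(1,2)] 2[OF ij(2,1)] 3 unfolding C'_def by blast
  qed
  then have "strip_state (N + 2) C'"
    unfolding strip_state_def using ham sub cross by blast
  then show ?thesis by blast
qed

text \<open>Lets simplification compute the arcs of a concrete cycle without indices modulo its
  length.\<close>

lemma cycle_arcs_Cons: "cycle_arcs (x # xs) = path_arcs (x # xs @ [x])"
proof -
  let ?n = "length xs"
  have eq: "((x # xs) ! i, (x # xs) ! ((i + 1) mod Suc ?n)) = ((x # xs @ [x]) ! i, (xs @ [x]) ! i)"
    if "i < Suc ?n" for i
  proof -
    have "(x # xs @ [x]) ! i = (x # xs) ! i"
      using that nth_append[of "x # xs" "[x]" i] by simp
    moreover have "(x # xs) ! ((i + 1) mod Suc ?n) = (xs @ [x]) ! i"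
      using that by (cases "i = ?n") (simp_all add: nth_append)
    ultimately show ?thesis by simp
  qed
  have "path_arcs (x # xs @ [x]) = (\<lambda>i. ((x # xs @ [x]) ! i, (xs @ [x]) ! i)) ` {..<Suc ?n}"
    unfolding path_arcs_def set_zip by auto
  also have "\<dots> = (\<lambda>i. ((x # xs) ! i, (x # xs) ! ((i + 1) mod Suc ?n))) ` {..<Suc ?n}"
    by (rule image_cong[OF refl]) (simp only: eq lessThan_iff)
  also have "\<dots> = cycle_arcs (x # xs)"
    unfolding cycle_arcs_def by auto
  finally show ?thesis by simp
qed

section \<open>Base cases of the band induction\<close>

definition strip_base3 :: "int option list list" where
  "strip_base3 =
    [[Some 0, Some 1, Some (-1), Some 3, Some 2, Some (-2), Some (-3), None],
     [Some 0, Some (-2), Some 2, Some (-3), Some 1, None, Some 3, Some (-1)],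
     [Some 0, Some (-1), Some 2, Some 3, None, Some 1, Some (-3), Some (-2)],
     [Some 0, None, Some (-1), Some 1, Some (-2), Some 3, Some (-3), Some 2],
     [Some 0, Some 2, Some (-1), None, Some (-3), Some 3, Some (-2), Some 1]]"

definition strip_base4 :: "int option list list" where
  "strip_base4 =
    [[Some 0, Some (-2), Some 3, Some (-1), Some 2, Some (-4), None, Some 4, Some (-3), Some 1],
     [Some 0, Some (-1), Some 1, Some (-3), Some 4, None, Some (-4), Some 3, Some (-2), Some 2],
     [Some 0, Some 1, None, Some (-1), Some 3, Some 4, Some (-4), Some (-3), Some 2, Some (-2)],
     [Some 0, Some 2, Some (-3), Some 3, Some (-4), Some 4, Some (-2), Some 1, Some (-1), None],
     [Some 0, None, Some 1, Some (-2), Some 4, Some 3, Some (-3), Some (-4), Some 2, Some (-1)]]"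

definition strip_base5 :: "int option list list" where
  "strip_base5 =
    [[Some 0, Some (-2), Some 4, Some (-5), None, Some 5, Some (-4), Some 3, Some (-1), Some 2, Some (-3), Some 1],
     [Some 0, Some (-1), Some 1, Some (-3), Some 5, None, Some (-5), Some 3, Some (-4), Some 4, Some (-2), Some 2],
     [Some 0, Some 1, None, Some (-1), Some 3, Some (-5), Some 4, Some (-4), Some 5, Some (-3), Some 2, Some (-2)],
     [Some 0, Some 2, Some (-4), Some (-5), Some 5, Some 4, Some (-3), Some 3, Some (-2), Some 1, Some (-1), None],
     [Some 0, None, Some 1, Some (-2), Some 3, Some (-3), Some 4, Some 5, Some (-5), Some (-4), Some 2, Some (-1)]]"

lemma strip_V_code: "strip_V N = set (None # map Some [-N..N])"
  by (simp add: strip_V_def)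

lemma ham_cycle_cycle_arcs:
  "length xs \<ge> 2 \<Longrightarrow> distinct xs \<Longrightarrow> set xs = V \<Longrightarrow> ham_cycle V (cycle_arcs xs)"
  unfolding ham_cycle_def by blast

lemma strip_base3:
  "j < 5 \<Longrightarrow> ham_cycle (strip_V 3) (cycle_arcs (strip_base3 ! j))"
  unfolding less_5_cases
  by (elim disjE; simp add: strip_base3_def ham_cycle_cycle_arcs strip_V_code upto.simps insert_commute)

lemma strip_base3_subset:
  "j < 5 \<Longrightarrow> cycle_arcs (strip_base3 ! j) \<subseteq> strip_A 3"
  unfolding less_5_cases
  by (elim disjE; simp add: strip_base3_def cycle_arcs_Cons strip_A_def)

lemma strip_base3_disjoint:
  "i < 5 \<Longrightarrow> j < 5 \<Longrightarrow> i \<noteq> j \<Longrightarrow>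
    cycle_arcs (strip_base3 ! i) \<inter> cycle_arcs (strip_base3 ! j) = {}"
  unfolding less_5_cases by (elim disjE) (simp_all add: strip_base3_def cycle_arcs_Cons)

lemma strip_base4:
  "j < 5 \<Longrightarrow> ham_cycle (strip_V 4) (cycle_arcs (strip_base4 ! j))"
  unfolding less_5_cases
  by (elim disjE; simp add: strip_base4_def ham_cycle_cycle_arcs strip_V_code upto.simps insert_commute)

lemma strip_base4_subset:
  "j < 5 \<Longrightarrow> cycle_arcs (strip_base4 ! j) \<subseteq> strip_A 4"
  unfolding less_5_cases
  by (elim disjE; simp add: strip_base4_def cycle_arcs_Cons strip_A_def)

lemma strip_base4_disjoint:
  "i < 5 \<Longrightarrow> j < 5 \<Longrightarrow> i \<noteq> j \<Longrightarrow>
    cycle_arcs (strip_base4 ! i) \<inter> cycle_arcs (strip_base4 ! j) = {}"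
  unfolding less_5_cases by (elim disjE) (simp_all add: strip_base4_def cycle_arcs_Cons)

lemma strip_base4_state: "strip_state 4 (\<lambda>j. cycle_arcs (strip_base4 ! j))"
proof -
  have "cycle_arcs (strip_base4 ! j) \<inter> crossing = some_arc ` set (cut_arcs ! j)" if "j < 5" for j
    using that unfolding less_5_cases
    by (elim disjE)
      (simp_all add: strip_base4_def cycle_arcs_Cons crossing_def some_arc_def cut_arcs_def
        Int_insert_left insert_commute)
  then show ?thesis
    by (simp add: strip_state_def strip_base4 strip_base4_subset strip_base4_disjoint)
qed

lemma strip_base5:
  "j < 5 \<Longrightarrow> ham_cycle (strip_V 5) (cycle_arcs (strip_base5 ! j))"
  unfolding less_5_cases
  by (elim disjE; simp add: strip_base5_def ham_cycle_cycle_arcs strip_V_code upto.simps insert_commute)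

lemma strip_base5_subset:
  "j < 5 \<Longrightarrow> cycle_arcs (strip_base5 ! j) \<subseteq> strip_A 5"
  unfolding less_5_cases
  by (elim disjE; simp add: strip_base5_def cycle_arcs_Cons strip_A_def)

lemma strip_base5_disjoint:
  "i < 5 \<Longrightarrow> j < 5 \<Longrightarrow> i \<noteq> j \<Longrightarrow>
    cycle_arcs (strip_base5 ! i) \<inter> cycle_arcs (strip_base5 ! j) = {}"
  unfolding less_5_cases by (elim disjE) (simp_all add: strip_base5_def cycle_arcs_Cons)

lemma strip_base5_state: "strip_state 5 (\<lambda>j. cycle_arcs (strip_base5 ! j))"
proof -
  have "cycle_arcs (strip_base5 ! j) \<inter> crossing = some_arc ` set (cut_arcs ! j)" if "j < 5" for j
    using that unfolding less_5_cases
    by (elim disjE)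
      (simp_all add: strip_base5_def cycle_arcs_Cons crossing_def some_arc_def cut_arcs_def
        Int_insert_left insert_commute)
  then show ?thesis
    by (simp add: strip_state_def strip_base5 strip_base5_subset strip_base5_disjoint)
qed

text \<open>The step adds 2, so the induction starts from both 4 and 5. The value 3 stands apart:
  the first of its cycles crosses the cut by one arc only instead of the four prescribed.\<close>

lemma strip_packing:
  assumes "N \<ge> 3"
  shows "ham_packing (strip_V N) (strip_A N) 5"
proof (cases "N = 3")
  case True
  then show ?thesis
    using strip_base3 strip_base3_subset strip_base3_disjoint by (intro ham_packingI[of "{..<5::nat}" 5 _ "\<lambda>j. cycle_arcs (strip_base3 ! j)"]) auto
next
  case False
  have "\<exists>C. strip_state (4 + int n) C" for n
  proof (induction n rule: induct_nat_012)
    case (ge2 n)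
    then show ?case using strip_step[of "4 + int n"] by (auto simp: algebra_simps)
  qed (use strip_base4_state strip_base5_state in auto)
  from this[of "nat (N - 4)"] obtain C where "strip_state N C"
    using False assms by auto
  then show ?thesis
    unfolding strip_state_def by (intro ham_packingI[of "{..<5::nat}" 5 _ C]) auto
qed

section \<open>Zigzag cycles and complete digraphs\<close>

text \<open>The part comes first, unlike in \<open>Kmp_V\<close>, and coordinates are integers,
  ready for modular arithmetic; \<open>Kmp_packing\<close> translates back.\<close>

definition mp_V :: "nat \<Rightarrow> nat \<Rightarrow> (int \<times> int) set" where
  "mp_V w l = {0..<int l} \<times> {0..<int w}"

definition mp_A :: "((int \<times> int) \<times> (int \<times> int)) set" where
  "mp_A = {(x, y). fst x \<noteq> fst y}"

text \<open>The sequence 0, 1, -1, 2, -2, ..., whose consecutive sums alternate between 1 and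
  0.\<close>

definition zigzag :: "nat \<Rightarrow> int" where
  "zigzag t = (if odd t then int (Suc t div 2) else - int (t div 2))"

text \<open>
  M is the point at infinity; it is joined to y by the 1-factor of sum 2y. Two consecutive sums form
  one class, that of a zigzag cycle.
\<close>
definition sum_class :: "int \<Rightarrow> int \<Rightarrow> int \<Rightarrow> int" where
  "sum_class M x y = (if x = M then 2 * y else if y = M then 2 * x else x + y) mod M div 2"

lemma zigzag_sum: "zigzag t + zigzag (Suc t) \<in> {0, 1}"
  by (auto simp: zigzag_def elim!: oddE evenE)

lemma zigzag_bounds: "t < M \<Longrightarrow> zigzag t \<le> int (M div 2) \<and> - int ((M - 1) div 2) \<le> zigzag t"
  by (auto simp: zigzag_def elim!: oddE evenE)

lemma zigzag_eq: "zigzag s = zigzag t \<Longrightarrow> s = t"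
  by (auto simp: zigzag_def elim!: oddE evenE split: if_splits)

lemma mod_div_2_class:
  fixes h M k :: int
  assumes "0 \<le> h" "2 * h + 1 < M" "k mod M = 2 * h \<or> k mod M = 2 * h + 1"
  shows "k mod M div 2 = h"
  using assms by auto

text \<open>The zigzag shifted by \<open>h\<close> runs through all residues modulo \<open>M\<close>
  with consecutive sums \<open>2 * h + 1\<close> and \<open>2 * h\<close>; the point at infinity
  closes it up.\<close>

lemma walecki_cycle:
  fixes h :: int and M :: nat
  assumes "0 \<le> h" "2 * h + 1 < int M"
  shows "\<exists>C. ham_cycle {0..int M} C \<and> (\<forall>(x, y)\<in>C. sum_class (int M) x y = h)"
proof -
  define z where "z t = (h + zigzag t) mod int M" for t
  \<comment> \<open>Positions 0 and \<open>M + 1\<close> both hold infinity, so position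
    \<open>t\<close> in between has zigzag index \<open>t - 1\<close>.\<close>
  define g where "g t = (if t = 0 \<or> t = Suc M then int M else z (t - 1))" for t
  let ?C = "(\<lambda>t. (g t, g (Suc t))) ` {..<Suc M}"
  have M: "M \<ge> 2" using assms by linarith
  have zr: "0 \<le> z t" "z t < int M" for t
    using M by (auto simp: z_def)
  have zinj: "s = t" if st: "z s = z t" "s < M" "t < M" for s t
  proof -
    have "(h + zigzag s) mod int M = (h + zigzag t) mod int M" using st(1) by (simp add: z_def)
    then have "int M dvd zigzag s - zigzag t" by (simp add: mod_eq_dvd_iff)
    moreover have "\<bar>zigzag s - zigzag t\<bar> < int M"
      using zigzag_bounds[OF st(2)] zigzag_bounds[OF st(3)] M by linarith
    ultimately have "zigzag s - zigzag t = 0"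
      using zdvd_not_zless[of "\<bar>zigzag s - zigzag t\<bar>" "int M"] by auto
    then show ?thesis using zigzag_eq by simp
  qed
  have inj: "inj_on g {..<Suc M}"
  proof (rule inj_onI)
    fix s t assume st: "s \<in> {..<Suc M}" "t \<in> {..<Suc M}" "g s = g t"
    show "s = t"
      using st zr(2)[of "s - 1"] zr(2)[of "t - 1"] zinj[of "s - 1" "t - 1"]
      by (cases s; cases t) (auto simp: g_def)
  qed
  have "g t \<in> {0..int M}" for t
    using zr[of "t - 1"] by (auto simp: g_def less_imp_le)
  then have "g ` {..<Suc M} \<subseteq> {0..int M}" by blast
  moreover have "card (g ` {..<Suc M}) = card {0..int M}"
    by (simp add: card_image[OF inj])
  ultimately have img: "g ` {..<Suc M} = {0..int M}"
    by (intro card_subset_eq) auto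
  have "ham_cycle {0..int M} ?C"
    by (rule ham_cycleI[OF _ inj _ img refl]) (use M in \<open>auto simp: g_def\<close>)
  moreover have "sum_class (int M) (g t) (g (Suc t)) = h" if t: "t < Suc M" for t
  proof -
    consider "t = 0" | "0 < t" "t < M" | "t = M" using t by linarith
    then show ?thesis
    proof cases
      case 1
      have "(2 * z 0) mod int M = 2 * h"
        using assms by (simp add: z_def zigzag_def)
      then show ?thesis
        using 1 M assms mod_div_2_class[OF assms, of "2 * z 0"] by (simp add: sum_class_def g_def)
    next
      case 2
      then obtain s where s: "t = Suc s" by (cases t) auto
      have "(z s + z (Suc s)) mod int M = (2 * h + (zigzag s + zigzag (Suc s))) mod int M"
        unfolding z_def mod_add_eq by (simp add: algebra_simps)
      also have "\<dots> = 2 * h + (zigzag s + zigzag (Suc s))"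
        using zigzag_sum[of s] assms by (intro mod_pos_pos_trivial) auto
      finally have "(z s + z (Suc s)) mod int M div 2 = h"
        using zigzag_sum[of s] by (intro mod_div_2_class[OF assms]) auto
      then show ?thesis
        using 2 s zr[of s] zr[of "Suc s"] by (simp add: sum_class_def g_def)
    next
      case 3
      \<comment> \<open>Twice the last zigzag term is 0 or 1 modulo \<open>M\<close>, depending on
        the parity of \<open>M\<close>; this puts the arc back to infinity into class
        \<open>h\<close>.\<close>
      have "2 * zigzag (M - 1) = int M \<or> 2 * zigzag (M - 1) = 1 - int M"
        using M by (cases "even M") (auto simp: zigzag_def elim!: evenE oddE)
      then have "2 * (h + zigzag (M - 1)) = 2 * h + int M * 1 \<or>
          2 * (h + zigzag (M - 1)) = 2 * h + 1 + int M * (-1)"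
        by auto
      moreover have "(2 * z (M - 1)) mod int M = (2 * (h + zigzag (M - 1))) mod int M"
        unfolding z_def by (simp add: mod_mult_right_eq)
      ultimately have "(2 * z (M - 1)) mod int M = 2 * h \<or> (2 * z (M - 1)) mod int M = 2 * h + 1"
        using assms by (metis add.commute add_nonneg_nonneg less_add_one less_trans mod_mult_self2
            mod_pos_pos_trivial mult_nonneg_nonneg zero_le_numeral zero_le_one)
      then show ?thesis
        using 3 M zr[of "M - 1"] mod_div_2_class[OF assms, of "2 * z (M - 1)"]
        by (auto simp: sum_class_def g_def)
    qed
  qed
  ultimately show ?thesis by (intro exI[of _ ?C]) auto
qed

text \<open>The class of an arc does not depend on its direction, so zigzag cycles of different
  classes are edge-disjoint and each can be traversed both ways.\<close>

lemma walecki_packing: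
  assumes "finite H" "\<And>h. h \<in> H \<Longrightarrow> 0 \<le> h \<and> 2 * h + 1 < int M" "M \<ge> 2"
  shows "ham_packing {0..int M} {(x, y). x \<noteq> y \<and> sum_class (int M) x y \<in> H} (2 * card H)"
proof -
  have "\<forall>h\<in>H. \<exists>C. ham_cycle {0..int M} C \<and> (\<forall>(x, y)\<in>C. sum_class (int M) x y = h)"
    using walecki_cycle assms(2) by blast
  then obtain f where f: "\<And>h. h \<in> H \<Longrightarrow> ham_cycle {0..int M} (f h)"
    "\<And>h x y. h \<in> H \<Longrightarrow> (x, y) \<in> f h \<Longrightarrow> sum_class (int M) x y = h"
    unfolding bchoice_iff by fast
  have c3: "card {0..int M} \<ge> 3" using assms(3) by simp
  have irrefl: "(x, x) \<notin> f h" if "h \<in> H" for h x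
    using ham_cycle_reverse_disjoint[OF f(1)[OF that] c3] by auto
  have sym: "sum_class (int M) y x = h" if "h \<in> H" "(x, y) \<in> f h" for h x y
    using f(2)[OF that] irrefl[OF that(1)] that(2) by (cases "x = y") (auto simp: sum_class_def add.commute split: if_splits)
  show ?thesis
  proof (rule ham_packing_reverse_closed[OF assms(1) refl c3 f(1)])
    show "f h \<union> (f h)\<inverse> \<subseteq> {(x, y). x \<noteq> y \<and> sum_class (int M) x y \<in> H}" if "h \<in> H" for h
      using f(2)[OF that] sym[OF that] irrefl[OF that] that by auto
    show "(f i \<union> (f i)\<inverse>) \<inter> (f j \<union> (f j)\<inverse>) = {}" if ij: "i \<in> H" "j \<in> H" "i \<noteq> j" for i j
    proof (rule equals0I)
      fix e assume "e \<in> (f i \<union> (f i)\<inverse>) \<inter> (f j \<union> (f j)\<inverse>)"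
      then obtain x y where e: "e = (x, y)" "(x, y) \<in> f i \<or> (y, x) \<in> f i" "(x, y) \<in> f j \<or> (y, x) \<in> f j"
        by (cases e) auto
      have "sum_class (int M) x y = i" "sum_class (int M) x y = j"
        using e(2,3) f(2) sym ij(1,2) by blast+
      then show False using ij(3) by simp
    qed
  qed
qed

section \<open>Complete digraphs of odd order and of even order at least 8\<close>

text \<open>The modulus \<open>l - 1\<close> is even, so its residues pair up completely into the
  sums \<open>2 * h\<close> and \<open>2 * h + 1\<close>.\<close>

lemma complete_packing_odd:
  assumes "odd l" "l \<ge> 3"
  shows "ham_packing {0..<int l} {(x, y). x \<noteq> y} (l - 1)"
proof -
  have "ham_packing {0..int (l - 1)}
    {(x, y). x \<noteq> y \<and> sum_class (int (l - 1)) x y \<in> {0..<int ((l - 1) div 2)}}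
    (2 * card {0..<int ((l - 1) div 2)})"
    using assms by (intro walecki_packing) (auto elim!: oddE)
  moreover have "2 * card {0..<int ((l - 1) div 2)} = l - 1"
    using assms by (auto elim!: oddE)
  moreover have "{0..int (l - 1)} = {0..<int l}"
    using assms by auto
  ultimately show ?thesis by (auto elim: ham_packing_mono)
qed

text \<open>Each label is shifted by \<open>N + 1\<close>, which raises sums by 1 modulo
  \<open>2 * N + 1\<close>: the band sums -2, ..., 2 become \<open>2 * N\<close>, 0, 1, 2, 3. Sums
  of large absolute value wrap around to these.\<close>

lemma strip_adj_sum:
  assumes "strip_adj N (Some x) (Some y)" "\<bar>x\<bar> \<le> N" "\<bar>y\<bar> \<le> N" "N \<ge> 3"
  shows "(x + y + 1) mod (2 * N + 1) \<in> {0, 1, 2, 3, 2 * N}"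
proof -
  let ?M = "2 * N + 1"
  have "0 \<le> x + y + 1 \<and> x + y + 1 \<le> 3 \<or> x + y + 1 = -1 \<or> x + y + 1 = 2 * N \<or> x + y + 1 = ?M \<or>
      x + y + 1 = 2 - ?M \<or> x + y + 1 = 3 - ?M"
    using assms unfolding strip_adj.simps by arith
  then consider "0 \<le> x + y + 1 \<and> x + y + 1 \<le> 3" | "x + y + 1 = -1" | "x + y + 1 = 2 * N"
    | "x + y + 1 = ?M" | "x + y + 1 = 2 - ?M" | "x + y + 1 = 3 - ?M"
    by blast
  then show ?thesis
  proof cases
    case 1
    then have "(x + y + 1) mod ?M = x + y + 1" using assms(4) by (intro mod_pos_pos_trivial) auto
    moreover have "x + y + 1 \<in> {0, 1, 2, 3}" using 1 by auto
    ultimately show ?thesis by auto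
  next
    case 2
    have "(-1) mod ?M = 2 * N" using assms(4) by (simp add: zmod_minus1)
    with 2 show ?thesis by (metis insertCI)
  next
    case 3
    then show ?thesis using assms(4) by (metis add.commute insertCI mod_pos_pos_trivial zless_add1_eq
      add_increasing2 zero_le_one mult_nonneg_nonneg zero_le_numeral order_trans)
  next
    case 5
    then have "(x + y + 1) mod ?M = 2 mod ?M" by (metis mod_minus_right minus_mod_self2)
    with assms(4) show ?thesis by simp
  next
    case 6
    then have "(x + y + 1) mod ?M = 3 mod ?M" by (metis minus_mod_self2)
    with assms(4) show ?thesis by simp
  qed auto
qed

text \<open>Now the modulus \<open>2 * N + 1\<close> is odd and the sum \<open>2 * N\<close> is
  alone in class \<open>N\<close>. The band graph absorbs it together with classes 0 and 1; zigzag
  cycles use the classes from 2 to \<open>N - 1\<close>.\<close>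

lemma complete_packing_even:
  assumes "even l" "l \<ge> 8"
  shows "ham_packing {0..<int l} {(x, y). x \<noteq> y} (l - 1)"
proof -
  define n where "n = l div 2 - 1"
  have l: "l = 2 * n + 2" and n: "n \<ge> 3"
    using assms by (auto simp: n_def)
  define N where "N = int n"
  define M where "M = 2 * N + 1"
  define f where "f x = (case x of None \<Rightarrow> M | Some x \<Rightarrow> (x + N + 1) mod M)" for x
  let ?L = "{(x, y). x \<noteq> y \<and> sum_class M x y \<in> {0, 1, N}}"
  let ?H = "{(x, y). x \<noteq> y \<and> sum_class M x y \<in> {2..<N}}"
  have M: "M > 0" "int (2 * n + 1) = M" using n by (auto simp: N_def M_def)
  have fr: "0 \<le> f (Some x)" "f (Some x) < M" for x
    using M by (auto simp: f_def)
  have inj: "inj_on f (strip_V N)"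
  proof (rule inj_onI)
    fix a b assume ab: "a \<in> strip_V N" "b \<in> strip_V N" "f a = f b"
    show "a = b"
    proof (cases a; cases b)
      fix x y assume xy: "a = Some x" "b = Some y"
      then have "(x + N + 1) mod M = (y + N + 1) mod M" using ab by (simp add: f_def)
      then have "M dvd x - y" by (simp add: mod_eq_dvd_iff)
      moreover have "\<bar>x - y\<bar> < M" using ab xy by (auto simp: strip_V_def M_def)
      ultimately have "x - y = 0"
        using zdvd_not_zless[of "\<bar>x - y\<bar>" M] by auto
      then show ?thesis using xy by simp
    next
      fix x assume "a = Some x" "b = None"
      then show ?thesis using ab fr[of x] by (simp add: f_def)
    next
      fix x assume "a = None" "b = Some x"
      then show ?thesis using ab fr[of x] by (simp add: f_def)
    qed simp
  qed
  have img: "f ` strip_V N = {0..M}"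
  proof (rule card_subset_eq)
    show "f ` strip_V N \<subseteq> {0..M}"
    proof
      fix y assume "y \<in> f ` strip_V N"
      then obtain a where "y = f a" by blast
      then show "y \<in> {0..M}" using fr M by (cases a) (auto simp: f_def less_imp_le)
    qed
    have "card (strip_V N) = Suc (card {-N..N})"
      by (simp add: strip_V_def card_insert_disjoint card_image image_iff)
    then show "card (f ` strip_V N) = card {0..M}"
      unfolding card_image[OF inj] by (simp add: M_def N_def)
  qed simp
  have cls: "sum_class M (f a) (f b) \<in> {0, 1, N}" "f a \<noteq> f b"
    if ab: "strip_adj N a b" "a \<in> strip_V N" "b \<in> strip_V N" for a b
  proof -
    have small: "s mod M div 2 \<in> {0, 1, N}" if "s mod M \<in> {0, 1, 2, 3, 2 * N}" for s
      using that by auto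
    have inf: "(2 * ((x + N + 1) mod M)) mod M \<in> {0, 1, 2, 3, 2 * N}" if adj: "strip_adj N None (Some x)" for x
    proof -
      have "(2 * ((x + N + 1) mod M)) mod M = (2 * (x + N + 1)) mod M"
        by (simp add: mod_mult_right_eq)
      also have "\<dots> = (2 * x + 1) mod M"
        by (simp add: mod_eq_dvd_iff M_def algebra_simps)
      also have "\<dots> \<in> {0, 1, 2, 3, 2 * N}"
      proof -
        \<comment> \<open>The last two cases are \<open>x = N\<close> and \<open>x = - N\<close>,
          written so that \<open>2 * x + 1\<close> reduces modulo \<open>M\<close>.\<close>
        have "x = 0 \<or> x = 1 \<or> x = -1 \<or> 2 * x + 1 = M \<or> 2 * x + 1 = 2 - M"
          using adj unfolding strip_adj.simps M_def by arith
        then consider "x = 0" | "x = 1" | "x = -1" | "2 * x + 1 = M" | "2 * x + 1 = 2 - M"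
          by blast
        then show ?thesis
        proof cases
          case 3
          have "(-1) mod M = 2 * N" using n by (simp add: zmod_minus1 M_def N_def)
          then show ?thesis using 3 by simp
        next
          case 5
          then have "(2 * x + 1) mod M = 2 mod M" by (metis minus_mod_self2)
          then show ?thesis using n by (simp add: M_def N_def)
        qed (use n in \<open>auto simp: M_def N_def\<close>)
      qed
      finally show ?thesis .
    qed
    show "sum_class M (f a) (f b) \<in> {0, 1, N}"
    proof (cases a; cases b)
      fix x y assume xy: "a = Some x" "b = Some y"
      have "(f a + f b) mod M = (2 * N + 1 + (x + y + 1)) mod M"
        unfolding xy f_def by (simp add: mod_add_eq algebra_simps)
      also have "\<dots> = (x + y + 1) mod M" unfolding M_def by (rule mod_add_self1)
      also have "\<dots> \<in> {0, 1, 2, 3, 2 * N}"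
        unfolding M_def using ab xy n by (intro strip_adj_sum) (auto simp: strip_V_def N_def)
      finally show ?thesis
        using small fr[of x] fr[of y] xy by (simp add: sum_class_def)
    next
      fix x assume "a = Some x" "b = None"
      then show ?thesis
        using small[OF inf[of x]] fr[of x] ab by (simp add: sum_class_def f_def)
    next
      fix x assume "a = None" "b = Some x"
      then show ?thesis
        using small[OF inf[of x]] fr[of x] ab by (simp add: sum_class_def f_def)
    qed (use ab in simp)
    have "a \<noteq> b" using ab by (cases a; cases b) auto
    then show "f a \<noteq> f b" using inj ab(2,3) by (auto simp: inj_on_def)
  qed
  have "ham_packing {0..M} ?L 5"
    using n cls by (intro ham_packing_map[OF strip_packing inj img]) (auto simp: N_def strip_A_def)
  moreover have "ham_packing {0..M} ?H (2 * card {2..<N})"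
    using walecki_packing[of "{2..<N}" "2 * n + 1"] n unfolding M(2) by (auto simp: M_def N_def)
  ultimately have "ham_packing {0..M} (?L \<union> ?H) (5 + 2 * card {2..<N})"
    using n by (intro ham_packing_Un) (auto simp: N_def)
  moreover have "5 + 2 * card {2..<N} = l - 1"
    using n by (simp add: l N_def)
  moreover have "{0..M} = {0..<int l}"
    by (auto simp: l M_def N_def)
  ultimately show ?thesis by (auto elim: ham_packing_mono)
qed

section \<open>Blow-ups of multipartite digraphs, and parts of size two\<close>

lemma mp_blow_up:
  assumes "ham_packing (mp_V w l) mp_A m" "w * l \<ge> 2" "u \<ge> 1" "even (w * l) \<or> odd u"
  shows "ham_packing (mp_V (w * u) l) mp_A (m * u)"
proof -
  \<comment> \<open>Copy \<open>a\<close> of the \<open>i\<close>-th vertex of part \<open>p\<close>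
    stays in part \<open>p\<close>, at place \<open>i * int u + a\<close>.\<close>
  let ?f = "\<lambda>((p, i), a). (p, i * int u + a) :: int \<times> int"
  have card: "card (mp_V w l) = w * l"
    by (simp add: mp_V_def card_cartesian_product mult.commute)
  have "ham_packing (mp_V w l \<times> {0..<int u})
    {(x, y). (fst x, fst y) \<in> mp_A \<and> snd x \<in> {0..<int u} \<and> snd y \<in> {0..<int u}} (m * u)"
    using assms by (intro ham_packing_blow_up) (auto simp: card)
  then show ?thesis
  proof (rule ham_packing_map[where f = ?f])
    show inj: "inj_on ?f (mp_V w l \<times> {0..<int u})"
    proof (rule inj_onI)
      fix x y assume xy: "x \<in> mp_V w l \<times> {0..<int u}" "y \<in> mp_V w l \<times> {0..<int u}" "?f x = ?f y"
      obtain p i a q j b where e: "x = ((p, i), a)" "y = ((q, j), b)"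
        by (metis surj_pair)
      have "i * int u + a = j * int u + b" "0 \<le> a" "a < int u" "0 \<le> b" "b < int u" "p = q"
        using xy e by auto
      moreover have "(k * int u + c) div int u = k" if "0 \<le> c" "c < int u" for k c
        using that by simp
      ultimately have "i = j" by metis
      then show "x = y" using e \<open>i * int u + a = j * int u + b\<close> \<open>p = q\<close> by simp
    qed
    show "?f ` (mp_V w l \<times> {0..<int u}) = mp_V (w * u) l"
    proof (rule card_subset_eq)
      show "finite (mp_V (w * u) l)" by (simp add: mp_V_def)
      show "?f ` (mp_V w l \<times> {0..<int u}) \<subseteq> mp_V (w * u) l"
      proof clarify
        fix p i a assume "(p, i) \<in> mp_V w l" "a \<in> {0..<int u}"
        then have *: "p \<in> {0..<int l}" "0 \<le> i" "i + 1 \<le> int w" "0 \<le> a" "a < int u"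
          by (auto simp: mp_V_def)
        then have "(i + 1) * int u \<le> int w * int u" by (intro mult_right_mono) auto
        then have "i * int u + a < int w * int u" using * by (simp add: algebra_simps)
        then show "(p, i * int u + a) \<in> mp_V (w * u) l"
          using * by (simp add: mp_V_def)
      qed
      show "card (?f ` (mp_V w l \<times> {0..<int u})) = card (mp_V (w * u) l)"
        unfolding card_image[OF inj] by (simp add: mp_V_def card_cartesian_product nat_mult_distrib)
    qed
  qed (auto simp: mp_A_def)
qed

lemma mp_packing_1:
  assumes "ham_packing {0..<int l} {(x, y). x \<noteq> y} m"
  shows "ham_packing (mp_V 1 l) mp_A m"
  using assms
  by (rule ham_packing_map[where f = "\<lambda>p. (p, 0)"]) (auto simp: mp_V_def mp_A_def inj_on_def)

text \<open>On \<open>2 * l\<close> points the modulus is odd, so the last sum \<open>M - 1\<close>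
  has no partner. Its arcs form a perfect matching, whose pairs serve as the parts.\<close>

lemma mp_packing_2:
  assumes "l \<ge> 2"
  shows "ham_packing (mp_V 2 l) mp_A (2 * (l - 1))"
proof -
  define M where "M = 2 * int l - 1"
  have M: "int (2 * l - 1) = M" using assms by (simp add: M_def)
  \<comment> \<open>Matched pairs are \<open>x\<close> and \<open>M - 1 - x\<close>, except that the
    fixed point \<open>l - 1\<close> of this reflection is matched with \<open>M\<close>.\<close>
  let ?f = "\<lambda>x. if x < int l then (x, 0) else if x < M then (M - 1 - x, 1) else (int l - 1, 1 :: int)"
  have "ham_packing {0..M} {(x, y). x \<noteq> y \<and> sum_class M x y \<in> {0..<int l - 1}} (2 * card {0..<int l - 1})"
    using walecki_packing[of "{0..<int l - 1}" "2 * l - 1"] assms unfolding M by (auto simp: M_def)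
  moreover have "2 * card {0..<int l - 1} = 2 * (l - 1)"
    using assms by simp
  ultimately have "ham_packing {0..M} {(x, y). x \<noteq> y \<and> sum_class M x y \<in> {0..<int l - 1}} (2 * (l - 1))"
    by simp
  then show ?thesis
  proof (rule ham_packing_map[where f = ?f])
    show inj: "inj_on ?f {0..M}"
      by (rule inj_onI) (auto simp: M_def split: if_splits)
    show "?f ` {0..M} = mp_V 2 l"
    proof (rule card_subset_eq)
      show "?f ` {0..M} \<subseteq> mp_V 2 l" using assms by (auto simp: mp_V_def M_def)
      show "card (?f ` {0..M}) = card (mp_V 2 l)"
        unfolding card_image[OF inj] using assms
        by (simp add: mp_V_def card_cartesian_product M_def)
    qed (simp add: mp_V_def)
    fix x y assume "(x, y) \<in> {(x, y). x \<noteq> y \<and> sum_class M x y \<in> {0..<int l - 1}}"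
      "x \<in> {0..M}" "y \<in> {0..M}"
    then have xy: "x \<noteq> y" "sum_class M x y \<noteq> int l - 1" "0 \<le> x" "x \<le> M" "0 \<le> y" "y \<le> M"
      by auto
    have *: "(M - 1) mod M div 2 = int l - 1"
      using assms by (simp add: M_def)
    show "(?f x, ?f y) \<in> mp_A"
    proof (rule ccontr)
      assume "(?f x, ?f y) \<notin> mp_A"
      then have "(if x = M then 2 * y else if y = M then 2 * x else x + y) = M - 1"
        using xy(1,3-6) assms by (auto simp: mp_A_def M_def split: if_splits)
      then show False using xy(2) * by (simp add: sum_class_def)
    qed
  qed
qed

section \<open>Four or six parts of odd size\<close>

definition row_rot :: "nat \<Rightarrow> nat" where
  "row_rot k = (if k = 0 then 1 else if k = 1 then 2 else if k = 2 then 0 else k)"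

definition row_swap :: "nat \<Rightarrow> nat" where
  "row_swap k = (if k = 1 then 2 else if k = 2 then 1 else k)"

text \<open>
  The path used by cycle j in row i: consecutive rows are related by the rotation in the first three
  transitions and by the swap afterwards, so for odd w the last row leads back to row 0.
\<close>
definition row_index :: "nat \<Rightarrow> nat \<Rightarrow> nat" where
  "row_index i j = (if i = 0 then j else if i = 1 then row_rot j else if i = 2 then row_rot (row_rot j)
     else if odd i then j else row_swap j)"

definition row_link :: "int list list \<Rightarrow> nat \<Rightarrow> nat \<Rightarrow> int \<times> int" where
  "row_link Ps k k' = (last (Ps ! k), hd (Ps ! k'))"

text \<open>These are the special arcs; \<open>row_check\<close> makes the links formed with
  \<open>row_swap\<close> the same arcs in some order.\<close>

definition row_links :: "nat \<Rightarrow> int list list \<Rightarrow> (int \<times> int) list" where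
  "row_links l Ps = map (\<lambda>k. row_link Ps k (row_rot k)) [0..<l - 1]"

definition row_step :: "int list list \<Rightarrow> nat \<times> nat \<Rightarrow> int \<times> int" where
  "row_step Ps = (\<lambda>(k, r). (Ps ! k ! r, Ps ! k ! Suc r))"

definition col_arc :: "nat \<Rightarrow> (int \<times> bool) list list \<Rightarrow> nat \<times> nat \<Rightarrow> int \<times> int" where
  "col_arc l Cs = (\<lambda>(c, r). (fst (Cs ! c ! r), fst (Cs ! c ! (Suc r mod l))))"

definition col_bit :: "(int \<times> bool) list list \<Rightarrow> nat \<times> nat \<Rightarrow> bool" where
  "col_bit Cs = (\<lambda>(c, r). snd (Cs ! c ! r))"

text \<open>The sign depends on the tail only; a Hamiltonian cycle leaves each vertex once, so for
  even \<open>l\<close> its signs cancel.\<close>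

definition col_sign :: "nat \<Rightarrow> int \<times> int \<Rightarrow> int" where
  "col_sign l a = (if fst a < int (l div 2) then 1 else - 1)"

text \<open>
  The cycles in Cs cover every arc twice, once with each bit. In group g the two occurrences carry the
  voltages 2g - 1 and 2g up to sign, except that special arcs carry 0 and 2 in group 1, because the
  cycles running through the rows use them with voltage 1 (and all other arcs with voltage 0). A
  Hamiltonian cycle has as many arcs of sign 1 as of sign -1, so its net voltage does not depend on g
  for g > 1.
\<close>
definition col_voltage ::
  "nat \<Rightarrow> int list list \<Rightarrow> (int \<times> bool) list list \<Rightarrow> int \<Rightarrow> nat \<times> nat \<Rightarrow> int" where
  "col_voltage l Ps Cs g cr = col_sign l (col_arc l Cs cr) *
     (if col_bit Cs cr then 2 * g
      else if g = 1 \<and> col_arc l Cs cr \<in> set (row_links l Ps) then 0 else 2 * g - 1)"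

definition row_check :: "nat \<Rightarrow> int list list \<Rightarrow> (int \<times> bool) list list \<Rightarrow> bool" where
  "row_check l Ps Cs \<longleftrightarrow> 4 \<le> l \<and>
     list_all (\<lambda>k. sort (Ps ! k) = map int [0..<l]) [0..<l - 1] \<and>
     distinct (map (row_step Ps) (List.product [0..<l - 1] [0..<l - 1]) @ row_links l Ps) \<and>
     distinct (map (\<lambda>k. row_link Ps k (row_swap k)) [0..<l - 1]) \<and>
     list_all (\<lambda>k. row_link Ps k (row_swap k) \<in> set (row_links l Ps)) [0..<l - 1] \<and>
     list_all (\<lambda>e. fst e \<noteq> snd e \<and> col_sign l e = 1) (row_links l Ps) \<and>
     list_all (\<lambda>c. sort (map fst (Cs ! c)) = map int [0..<l]) [0..<2 * (l - 1)] \<and>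
     distinct (map (\<lambda>cr. (col_arc l Cs cr, col_bit Cs cr)) (List.product [0..<2 * (l - 1)] [0..<l])) \<and>
     list_all (\<lambda>c. (\<Sum>r\<leftarrow>[0..<l]. col_sign l (col_arc l Cs (c, r))) = 0 \<and>
       (\<Sum>r\<leftarrow>[0..<l]. col_voltage l Ps Cs 1 (c, r)) \<in> set [1, -1, 2, -2, 4, -4] \<and>
       (\<Sum>r\<leftarrow>[0..<l]. col_sign l (col_arc l Cs (c, r)) * of_bool (col_bit Cs (c, r)))
         \<in> set [1, -1, 2, -2, 4, -4]) [0..<2 * (l - 1)]"

lemma row_rot_eq_iff: "row_rot j = row_rot j' \<longleftrightarrow> j = j'"
  by (simp add: row_rot_def)

lemma row_swap_eq_iff: "row_swap j = row_swap j' \<longleftrightarrow> j = j'"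
  by (simp add: row_swap_def)

locale row_system =
  fixes l w :: nat and Ps :: "int list list" and Cs :: "(int \<times> bool) list list"
  assumes check: "row_check l Ps Cs" and w: "odd w" "3 \<le> w"
begin

definition E :: "(int \<times> int) set" where "E = set (row_links l Ps)"

lemma l: "4 \<le> l" using check by (simp add: row_check_def)

lemma sorted_list:
  assumes "sort xs = map int [0..<l]"
  shows "length xs = l" "distinct xs" "set xs = {0..<int l}"
proof -
  show "length xs = l" using arg_cong[OF assms, of length] by simp
  have "distinct (sort xs)" unfolding assms by (simp add: distinct_map)
  then show "distinct xs" by simp
  have "set (sort xs) = {0..<int l}" unfolding assms by (simp add: image_int_atLeastLessThan)
  then show "set xs = {0..<int l}" by simp
qed

lemma path:
  assumes "k < l - 1"
  shows "length (Ps ! k) = l" "distinct (Ps ! k)" "set (Ps ! k) = {0..<int l}"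
  using sorted_list[of "Ps ! k"] check assms by (auto simp: row_check_def list_all_iff)

lemma step_eq:
  assumes "row_step Ps (k, r) = row_step Ps (k', r')" "k < l - 1" "r < l - 1" "k' < l - 1" "r' < l - 1"
  shows "k = k'"
proof -
  have "inj_on (row_step Ps) ({0..<l - 1} \<times> {0..<l - 1})"
    using check by (simp add: row_check_def distinct_map)
  from inj_onD[OF this assms(1)] show ?thesis using assms by simp
qed

lemma step_not_link: "k < l - 1 \<Longrightarrow> r < l - 1 \<Longrightarrow> row_step Ps (k, r) \<notin> E"
proof -
  assume "k < l - 1" "r < l - 1"
  moreover have "row_step Ps ` ({0..<l - 1} \<times> {0..<l - 1}) \<inter> E = {}"
    using check by (simp add: row_check_def E_def)
  moreover have "(k, r) \<in> {0..<l - 1} \<times> {0..<l - 1}"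
    using calculation(1,2) by simp
  ultimately show ?thesis by blast
qed

lemma rot_link: "k < l - 1 \<Longrightarrow> row_link Ps k (row_rot k) \<in> E"
  by (auto simp: E_def row_links_def)

lemma swap_link: "k < l - 1 \<Longrightarrow> row_link Ps k (row_swap k) \<in> E"
  using check by (auto simp: E_def row_check_def list_all_iff)

lemma rot_link_eq:
  assumes "row_link Ps k (row_rot k) = row_link Ps k' (row_rot k')" "k < l - 1" "k' < l - 1"
  shows "k = k'"
proof -
  have "inj_on (\<lambda>k. row_link Ps k (row_rot k)) {0..<l - 1}"
    using check by (simp add: row_check_def row_links_def distinct_map)
  from inj_onD[OF this assms(1)] show ?thesis using assms by simp
qed

lemma swap_link_eq:
  assumes "row_link Ps k (row_swap k) = row_link Ps k' (row_swap k')" "k < l - 1" "k' < l - 1"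
  shows "k = k'"
proof -
  have "inj_on (\<lambda>k. row_link Ps k (row_swap k)) {0..<l - 1}"
    using check by (simp add: row_check_def distinct_map)
  from inj_onD[OF this assms(1)] show ?thesis using assms by simp
qed

lemma link: "e \<in> E \<Longrightarrow> fst e \<noteq> snd e \<and> col_sign l e = 1"
  using check by (auto simp: E_def row_check_def list_all_iff)

lemma row_index_less: "j < l - 1 \<Longrightarrow> row_index i j < l - 1"
  using l by (auto simp: row_index_def row_rot_def row_swap_def)

lemma row_index_eq: "row_index i j = row_index i j' \<Longrightarrow> j = j'"
  by (simp add: row_index_def row_rot_eq_iff row_swap_eq_iff split: if_splits)

text \<open>The rule persists from the last row back to row 0 because three rotations and an even
  number \<open>w - 3\<close> of swaps compose to the identity.\<close>

lemma row_index_next: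
  assumes "i < w"
  shows "row_index (Suc i mod w) j =
    (if i < 3 then row_rot (row_index i j) else row_swap (row_index i j))"
proof -
  have rot3: "row_rot (row_rot (row_rot j)) = j" and swap2: "row_swap (row_swap j) = j"
    by (auto simp: row_rot_def row_swap_def)
  show ?thesis
  proof (cases "Suc i = w")
    case True
    then have "even i" "2 \<le> i" using w by auto
    then show ?thesis
      using True rot3 swap2 by (cases "i = 2") (auto simp: row_index_def)
  next
    case False
    then have "Suc i mod w = Suc i" using assms by simp
    moreover have "i = 0 \<or> i = 1 \<or> i = 2 \<or> 3 \<le> i" by linarith
    ultimately show ?thesis
      using rot3 swap2 by (elim disjE) (auto simp: row_index_def numeral_3_eq_3)
  qed
qed

section \<open>Cycles running through the rows\<close>

text \<open>Ordinary arcs with voltage 0 and special arcs with voltage 1. Whatever the single row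
  cycles look like, this set and its complement are invariant under shifting the rows.\<close>

definition A0 :: "((int \<times> int) \<times> (int \<times> int)) set" where
  "A0 = {((p, a), (q, b)). p \<noteq> q \<and> (b - a) mod int w = of_bool ((p, q) \<in> E)}"

text \<open>The reduction modulo \<open>w\<close> closes the walk: step \<open>w * l\<close> is back
  at the start in row 0.\<close>

definition row_cycle :: "nat \<Rightarrow> nat \<Rightarrow> int \<times> int" where
  "row_cycle j s = (Ps ! row_index (s div l mod w) j ! (s mod l), int (s div l mod w))"

definition row_arcs :: "nat \<Rightarrow> ((int \<times> int) \<times> (int \<times> int)) set" where
  "row_arcs j = (\<lambda>s. (row_cycle j s, row_cycle j (Suc s))) ` {..<w * l}"

lemma row_cycle_ham:
  assumes j: "j < l - 1"
  shows "ham_cycle (mp_V w l) (row_arcs j)"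
proof -
  have l0: "0 < l" using l by simp
  have div: "s div l mod w = s div l" if "s < w * l" for s
    using that l0 by (simp add: less_mult_imp_div_less)
  have inj: "inj_on (row_cycle j) {..<w * l}"
  proof (rule inj_onI)
    fix s t assume st: "s \<in> {..<w * l}" "t \<in> {..<w * l}" "row_cycle j s = row_cycle j t"
    then have d: "s div l = t div l"
      using div by (auto simp: row_cycle_def)
    let ?P = "Ps ! row_index (s div l mod w) j"
    have "?P ! (s mod l) = ?P ! (t mod l)"
      using st(3) d by (simp add: row_cycle_def)
    then have "s mod l = t mod l"
      using path[OF row_index_less[OF j, of "s div l mod w"]] l0 by (simp add: nth_eq_iff_index_eq)
    with d show "s = t" by (metis div_mult_mod_eq)
  qed
  have "row_cycle j s \<in> mp_V w l" for s
  proof -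
    have "Ps ! row_index (s div l mod w) j ! (s mod l) \<in> {0..<int l}"
      using path[OF row_index_less[OF j, of "s div l mod w"]] l0
      by (metis mod_less_divisor nth_mem)
    then show ?thesis using w by (simp add: row_cycle_def mp_V_def)
  qed
  then have "row_cycle j ` {..<w * l} \<subseteq> mp_V w l" by blast
  moreover have "card (row_cycle j ` {..<w * l}) = card (mp_V w l)"
    unfolding card_image[OF inj] by (simp add: mp_V_def card_cartesian_product)
  ultimately have img: "row_cycle j ` {..<w * l} = mp_V w l"
    by (intro card_subset_eq) (auto simp: mp_V_def)
  have "1 * 4 \<le> w * l" using l w by (intro mult_le_mono) auto
  then show ?thesis
    unfolding row_arcs_def
    by (intro ham_cycleI[OF _ inj _ img refl]) (use l0 in \<open>auto simp: row_cycle_def\<close>)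
qed

lemma row_arcs_cases:
  assumes "e \<in> row_arcs j" "j < l - 1"
  obtains (step) i r where "i < w" "r < l - 1"
      "e = ((fst (row_step Ps (row_index i j, r)), int i), (snd (row_step Ps (row_index i j, r)), int i))"
    | (link) i where "i < w"
      "e = ((fst (row_link Ps (row_index i j) (row_index (Suc i mod w) j)), int i),
        (snd (row_link Ps (row_index i j) (row_index (Suc i mod w) j)), int (Suc i mod w)))"
proof -
  have l0: "0 < l" using l by simp
  obtain s where s: "s < w * l" "e = (row_cycle j s, row_cycle j (Suc s))"
    using assms(1) by (auto simp: row_arcs_def)
  define i r where "i = s div l" and "r = s mod l"
  have i: "i < w" using s(1) by (simp add: i_def less_mult_imp_div_less)
  have r: "r < l" using l0 by (simp add: r_def)
  let ?P = "Ps ! row_index i j" and ?Q = "Ps ! row_index (Suc i mod w) j"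
  have len: "length ?P = l" "length ?Q = l"
    by (rule path(1)[OF row_index_less[OF assms(2)]])+
  then have P: "length ?P = l" "?P \<noteq> []" "?Q \<noteq> []"
    using l0 by (metis less_irrefl list.size(3))+
  show ?thesis
  proof (cases "Suc r = l")
    case False
    then have "Suc s mod l = Suc r" "Suc s div l = i"
      using r by (auto simp: i_def r_def mod_Suc div_Suc)
    then have "e = ((?P ! r, int i), (?P ! Suc r, int i))"
      using s(2) i by (simp add: row_cycle_def i_def[symmetric] r_def[symmetric])
    then show ?thesis using step[of i r] i r False by (simp add: row_step_def)
  next
    case True
    then have "Suc s mod l = 0" "Suc s div l = Suc i"
      using r by (auto simp: i_def r_def mod_Suc div_Suc)
    then have "e = ((?P ! r, int i), (?Q ! 0, int (Suc i mod w)))"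
      using s(2) i by (simp add: row_cycle_def i_def[symmetric] r_def[symmetric])
    moreover have "?P ! r = last ?P" "?Q ! 0 = hd ?Q"
      using P True[symmetric] by (simp_all add: last_conv_nth hd_conv_nth)
    ultimately show ?thesis using link[of i] i by (simp add: row_link_def)
  qed
qed

lemma row_link_E: "i < w \<Longrightarrow> j < l - 1 \<Longrightarrow> row_link Ps (row_index i j) (row_index (Suc i mod w) j) \<in> E"
  using rot_link swap_link row_index_less by (simp add: row_index_next)

lemma row_arcs_subset:
  assumes j: "j < l - 1"
  shows "row_arcs j \<subseteq> A0"
proof
  fix e assume "e \<in> row_arcs j"
  then show "e \<in> A0"
    using j
  proof (cases rule: row_arcs_cases)
    case (step i r)
    let ?k = "row_index i j"
    have k: "?k < l - 1" by (rule row_index_less[OF j])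
    have "Ps ! ?k ! r \<noteq> Ps ! ?k ! Suc r"
      using path[OF k] step(2) by (simp add: nth_eq_iff_index_eq)
    then show ?thesis
      using step step_not_link[OF k step(2)] by (simp add: A0_def row_step_def)
  next
    case (link i)
    let ?e = "row_link Ps (row_index i j) (row_index (Suc i mod w) j)"
    have e: "?e \<in> E" by (rule row_link_E[OF link(1) j])
    \<comment> \<open>This includes the passage from the last row to row 0, where the difference is
      \<open>1 - w\<close>.\<close>
    have "(int (Suc i mod w) - int i) mod int w = 1"
      using w by (simp add: zmod_int mod_diff_left_eq)
    then show ?thesis
      using link(2) e row_system.link[OF row_system_axioms e] by (simp add: A0_def)
  qed
qed

text \<open>A step stays in its row while a link leaves it, so only arcs of the same kind can
  coincide. Row and arc then determine the path, and row and path determine the cycle.\<close>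

lemma row_arcs_disjoint:
  assumes j: "j < l - 1" "j' < l - 1" "j \<noteq> j'"
  shows "row_arcs j \<inter> row_arcs j' = {}"
proof (rule equals0I)
  fix e assume e: "e \<in> row_arcs j \<inter> row_arcs j'"
  have next_neq: "int i \<noteq> int (Suc i mod w)" if "i < w" for i
    using that w by (cases "Suc i = w") auto
  from e have "e \<in> row_arcs j" "e \<in> row_arcs j'" by auto
  from this(1) j(1) show False
  proof (cases rule: row_arcs_cases)
    case 1: (step i r)
    from \<open>e \<in> row_arcs j'\<close> j(2) show False
    proof (cases rule: row_arcs_cases)
      case (step i' r')
      have "row_index i j = row_index i j'"
        by (rule step_eq[of _ r _ r'])
          (use 1 step row_index_less j in \<open>auto simp: prod_eq_iff\<close>)
      then show False using row_index_eq j(3) by blast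
    next
      case (link i')
      then show False using 1 next_neq[of i'] by auto
    qed
  next
    case 1: (link i)
    from \<open>e \<in> row_arcs j'\<close> j(2) show False
    proof (cases rule: row_arcs_cases)
      case (step i' r')
      then show False using 1 next_neq[of i] by auto
    next
      case (link i')
      then have "i = i'" using 1 by simp
      then have "row_link Ps (row_index i j) (row_index (Suc i mod w) j) =
          row_link Ps (row_index i j') (row_index (Suc i mod w) j')"
        using 1 link by (simp add: prod_eq_iff)
      then have "row_index i j = row_index i j'"
        using rot_link_eq swap_link_eq row_index_less j 1(1) by (auto simp: row_index_next split: if_splits)
      then show False using row_index_eq j(3) by blast
    qed
  qed
qed

lemma row_packing: "ham_packing (mp_V w l) A0 (l - 1)"
  by (rule ham_packingI[of "{..<l - 1}" _ _ row_arcs])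
    (use row_cycle_ham row_arcs_subset row_arcs_disjoint in auto)

section \<open>Cycles invariant under shifting the rows\<close>

lemma col:
  assumes "c < 2 * (l - 1)"
  shows "length (Cs ! c) = l" "distinct (map fst (Cs ! c))" "set (map fst (Cs ! c)) = {0..<int l}"
  using sorted_list[of "map fst (Cs ! c)"] check assms by (auto simp: row_check_def list_all_iff)

lemma col_eq:
  assumes "col_arc l Cs (c, r) = col_arc l Cs (c', r')" "col_bit Cs (c, r) = col_bit Cs (c', r')"
    "c < 2 * (l - 1)" "r < l" "c' < 2 * (l - 1)" "r' < l"
  shows "c = c'"
proof -
  have "inj_on (\<lambda>cr. (col_arc l Cs cr, col_bit Cs cr)) ({0..<2 * (l - 1)} \<times> {0..<l})"
    using check by (simp add: row_check_def distinct_map)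
  from inj_onD[OF this, of "(c, r)" "(c', r')"] show ?thesis using assms by simp
qed

lemma col_net_coprime:
  assumes "c < 2 * (l - 1)"
  shows "coprime (\<Sum>r<l. col_voltage l Ps Cs g (c, r)) (int w)"
proof -
  have U: "coprime x (int w)" if "x \<in> {1, -1, 2, -2, 4, -4}" for x
  proof -
    have "coprime 2 (int w)" using w by simp
    moreover have "coprime 4 (int w)"
      using coprime_power_left_iff[of 2 2 "int w"] w by simp
    ultimately show ?thesis using that by auto
  qed
  have lst: "(\<Sum>r\<leftarrow>[0..<l]. f r) = (\<Sum>r<l. f r)" for f :: "nat \<Rightarrow> int"
    by (simp add: interv_sum_list_conv_sum_set_nat atLeast0LessThan)
  have c: "(\<Sum>r<l. col_sign l (col_arc l Cs (c, r))) = 0"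
    "(\<Sum>r<l. col_voltage l Ps Cs 1 (c, r)) \<in> {1, -1, 2, -2, 4, -4}"
    "(\<Sum>r<l. col_sign l (col_arc l Cs (c, r)) * of_bool (col_bit Cs (c, r))) \<in> {1, -1, 2, -2, 4, -4}"
    using check assms unfolding row_check_def list_all_iff lst by auto
  show ?thesis
  proof (cases "g = 1")
    case True
    then show ?thesis using U c(2) by simp
  next
    case False
    \<comment> \<open>Each voltage is the sign times \<open>2 * g - 1\<close> plus the sign times
      the bit; the first part cancels as the signs sum to 0.\<close>
    have "(\<Sum>r<l. col_voltage l Ps Cs g (c, r)) =
      (\<Sum>r<l. (2 * g - 1) * col_sign l (col_arc l Cs (c, r)) +
        col_sign l (col_arc l Cs (c, r)) * of_bool (col_bit Cs (c, r)))"
      using False by (intro sum.cong) (auto simp: col_voltage_def algebra_simps)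
    also have "\<dots> = (2 * g - 1) * (\<Sum>r<l. col_sign l (col_arc l Cs (c, r))) +
        (\<Sum>r<l. col_sign l (col_arc l Cs (c, r)) * of_bool (col_bit Cs (c, r)))"
      by (simp add: sum.distrib sum_distrib_left)
    finally show ?thesis using U c(1,3) by simp
  qed
qed

definition col_arcs :: "nat \<Rightarrow> int \<Rightarrow> ((int \<times> int) \<times> (int \<times> int)) set" where
  "col_arcs c g = {((fst (col_arc l Cs (c, r)), a),
      (snd (col_arc l Cs (c, r)), (a + col_voltage l Ps Cs g (c, r)) mod int w)) | r a.
    r < l \<and> a \<in> {0..<int w}}"

lemma col_arcs_ham:
  assumes c: "c < 2 * (l - 1)"
  shows "ham_cycle (mp_V w l) (col_arcs c g)"
proof -
  let ?g = "\<lambda>r. map fst (Cs ! c) ! (r mod l)"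
  have l0: "2 \<le> l" using l by simp
  have inj: "inj_on ?g {..<l}"
    using col[OF c] by (auto simp: inj_on_def nth_eq_iff_index_eq simp del: nth_map)
  have img: "?g ` {..<l} = {0..<int l}"
  proof -
    have "?g ` {..<l} = set (map fst (Cs ! c))"
      using col(1)[OF c] by (subst set_conv_nth) (auto simp del: nth_map)
    then show ?thesis using col(3)[OF c] by simp
  qed
  have eq: "?g r = fst (col_arc l Cs (c, r))" "?g (Suc r) = snd (col_arc l Cs (c, r))" if "r < l" for r
    using that col(1)[OF c] l0 by (auto simp: col_arc_def)
  have "col_arcs c g = {((?g r, a), (?g (Suc r), (a + col_voltage l Ps Cs g (c, r)) mod int w)) | r a.
      r < l \<and> a \<in> {0..<int w}}"
    unfolding col_arcs_def by (rule Collect_cong, rule ex_cong1, rule ex_cong1) (auto simp: eq[symmetric] simp del: nth_map)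
  then show ?thesis
    unfolding mp_V_def img[symmetric]
    using ham_cycle_lift[OF l0 inj, of w "\<lambda>r. col_voltage l Ps Cs g (c, r)"] col_net_coprime[OF c] w
    by simp
qed

text \<open>Over all groups, the magnitudes of an ordinary arc are 1, ..., \<open>w - 1\<close> and
  those of a special arc are 0, ..., \<open>w - 1\<close> except 1, so that just the lifts in
  \<open>A0\<close> are left out.\<close>

definition magnitude :: "int \<Rightarrow> nat \<times> nat \<Rightarrow> int" where
  "magnitude g cr = (if col_bit Cs cr then 2 * g
     else if g = 1 \<and> col_arc l Cs cr \<in> E then 0 else 2 * g - 1)"

lemma voltage: "col_voltage l Ps Cs g cr = col_sign l (col_arc l Cs cr) * magnitude g cr"
  by (simp add: col_voltage_def magnitude_def E_def)

lemma magnitude_range: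
  assumes "g \<in> {1..int ((w - 1) div 2)}"
  shows "0 \<le> magnitude g cr" "magnitude g cr < int w"
  using assms w by (auto simp: magnitude_def elim!: oddE)

lemma signed_mod_eq:
  assumes "(col_sign l e * m) mod int w = (col_sign l e * n) mod int w"
    "0 \<le> m" "m < int w" "0 \<le> n" "n < int w"
  shows "m = n"
proof -
  have "int w dvd col_sign l e * m - col_sign l e * n" using assms(1) by (simp add: mod_eq_dvd_iff)
  also have "col_sign l e * m - col_sign l e * n = col_sign l e * (m - n)" by (simp add: algebra_simps)
  finally have "int w dvd m - n"
    by (cases "fst e < int (l div 2)") (simp_all add: col_sign_def dvd_diff_commute)
  then have "m mod int w = n mod int w" by (simp add: mod_eq_dvd_iff)
  then show ?thesis using assms by simp
qed

lemma col_arcs_subset: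
  assumes c: "c < 2 * (l - 1)" and g: "g \<in> {1..int ((w - 1) div 2)}"
  shows "col_arcs c g \<subseteq> mp_A - A0"
proof
  fix e assume "e \<in> col_arcs c g"
  then obtain r a where e: "r < l" "a \<in> {0..<int w}"
    "e = ((fst (col_arc l Cs (c, r)), a),
      (snd (col_arc l Cs (c, r)), (a + col_voltage l Ps Cs g (c, r)) mod int w))"
    unfolding col_arcs_def by blast
  let ?x = "col_arc l Cs (c, r)"
  have "fst (Cs ! c ! r) \<noteq> fst (Cs ! c ! (Suc r mod l))"
  proof
    assume "fst (Cs ! c ! r) = fst (Cs ! c ! (Suc r mod l))"
    then have "map fst (Cs ! c) ! r = map fst (Cs ! c) ! (Suc r mod l)"
      using e(1) col(1)[OF c] by simp
    moreover have "Suc r mod l < l" using l by simp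
    ultimately have "r = Suc r mod l"
      using col(1,2)[OF c] e(1) by (simp add: nth_eq_iff_index_eq del: nth_map)
    then show False using e(1) l by (cases "Suc r = l") auto
  qed
  then have "e \<in> mp_A" by (simp add: e(3) mp_A_def col_arc_def)
  moreover have "e \<notin> A0"
  proof
    assume "e \<in> A0"
    then have *: "(col_sign l ?x * magnitude g (c, r)) mod int w = of_bool (?x \<in> E)"
      by (simp add: A0_def e(3) mod_diff_left_eq voltage)
    show False
    proof (cases "?x \<in> E")
      case True
      \<comment> \<open>Special arcs have sign 1; with sign -1 the magnitude \<open>w - 1\<close>
        would also reduce to 1.\<close>
      then have "magnitude g (c, r) = 1"
        using * magnitude_range[OF g, of "(c, r)"] link[OF True] by simp
      then show False
        using True g unfolding magnitude_def by (simp split: if_splits) presburger+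
    next
      case False
      then have "(col_sign l ?x * magnitude g (c, r)) mod int w = (col_sign l ?x * 0) mod int w"
        using * by simp
      then have "magnitude g (c, r) = 0"
        by (rule signed_mod_eq) (use magnitude_range[OF g, of "(c, r)"] w in simp_all)
      then show False using False g by (auto simp: magnitude_def split: if_splits)
    qed
  qed
  ultimately show "e \<in> mp_A - A0" by blast
qed

text \<open>A common arc fixes the underlying arc of the complete digraph and the voltage. The
  magnitude then reveals group and bit, and arc and bit determine the cycle.\<close>

lemma col_arcs_disjoint:
  assumes "c < 2 * (l - 1)" "g \<in> {1..int ((w - 1) div 2)}"
    and "c' < 2 * (l - 1)" "g' \<in> {1..int ((w - 1) div 2)}" "(c, g) \<noteq> (c', g')"
  shows "col_arcs c g \<inter> col_arcs c' g' = {}"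
proof (rule equals0I)
  fix e assume "e \<in> col_arcs c g \<inter> col_arcs c' g'"
  then have "e \<in> col_arcs c g" "e \<in> col_arcs c' g'" by auto
  then obtain r a r' a' where e': "r < l" "r' < l"
    "e = ((fst (col_arc l Cs (c, r)), a),
      (snd (col_arc l Cs (c, r)), (a + col_voltage l Ps Cs g (c, r)) mod int w))"
    "e = ((fst (col_arc l Cs (c', r')), a'),
      (snd (col_arc l Cs (c', r')), (a' + col_voltage l Ps Cs g' (c', r')) mod int w))"
    unfolding col_arcs_def by blast
  then have e: "r < l" "r' < l" "col_arc l Cs (c, r) = col_arc l Cs (c', r')"
    "(a + col_voltage l Ps Cs g (c, r)) mod int w = (a + col_voltage l Ps Cs g' (c', r')) mod int w"
    by (metis Pair_inject prod.collapse)+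
  let ?s = "col_sign l (col_arc l Cs (c, r))"
  have "(?s * magnitude g (c, r)) mod int w = (?s * magnitude g' (c', r')) mod int w"
    using e(3,4) by (simp add: mod_eq_dvd_iff voltage)
  then have "magnitude g (c, r) = magnitude g' (c', r')"
    by (rule signed_mod_eq) (use magnitude_range[OF assms(2)] magnitude_range[OF assms(4)] in simp_all)
  then have "g = g' \<and> col_bit Cs (c, r) = col_bit Cs (c', r')"
    using e(3) assms(2,4) unfolding magnitude_def
    by (cases "col_bit Cs (c, r)"; cases "col_bit Cs (c', r')") (simp_all split: if_splits, presburger+)
  then show False
    using col_eq[OF e(3) _ assms(1) e(1) assms(3) e(2)] assms(5) by simp
qed

lemma col_packing: "ham_packing (mp_V w l) (mp_A - A0) (2 * (l - 1) * ((w - 1) div 2))"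
proof (rule ham_packingI)
  let ?I = "{..<2 * (l - 1)} \<times> {1..int ((w - 1) div 2)}"
  show "finite ?I" "card ?I = 2 * (l - 1) * ((w - 1) div 2)"
    by (simp_all add: card_cartesian_product)
  fix x assume x: "x \<in> ?I"
  then show "ham_cycle (mp_V w l) (case x of (c, g) \<Rightarrow> col_arcs c g)"
    by (cases x) (simp add: col_arcs_ham)
  show "(case x of (c, g) \<Rightarrow> col_arcs c g) \<subseteq> mp_A - A0"
    using x by (cases x) (simp only: mem_Times_iff fst_conv snd_conv lessThan_iff prod.case col_arcs_subset)
  fix y assume y: "y \<in> ?I" "x \<noteq> y"
  show "(case x of (c, g) \<Rightarrow> col_arcs c g) \<inter> (case y of (c, g) \<Rightarrow> col_arcs c g) = {}"
    using x y by (cases x; cases y)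
      (simp only: mem_Times_iff fst_conv snd_conv lessThan_iff prod.case col_arcs_disjoint not_False_eq_True)
qed

lemma packing: "ham_packing (mp_V w l) mp_A (w * (l - 1))"
proof -
  obtain n where n: "w = 2 * n + 1" using w(1) by (rule oddE)
  \<comment> \<open>With \<open>m = l - 1\<close> this adds up the row cycles and the
    shift-invariant ones.\<close>
  have "m + 2 * m * ((w - 1) div 2) = w * m" for m
    by (simp add: n algebra_simps)
  moreover have "A0 \<union> (mp_A - A0) = mp_A" by (auto simp: A0_def mp_A_def)
  ultimately show ?thesis
    using ham_packing_Un[OF row_packing col_packing] by (simp add: Diff_disjoint)
qed

end

text \<open>The special arcs are (0, 2), (1, 3) and (0, 1).\<close>

definition rows4 :: "int list list" where
  "rows4 =
    [[1, 2, 3, 0],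
     [2, 0, 3, 1],
     [3, 2, 1, 0]]"

text \<open>An entry is a vertex with the bit, written 0 or 1, of the arc leaving it.\<close>

definition cols4 :: "(int \<times> bool) list list" where
  "cols4 = map (map (map_prod id (\<lambda>b. b = (1 :: int))))
    [[(0, 0), (1, 0), (2, 1), (3, 0)],
     [(0, 1), (1, 1), (3, 0), (2, 0)],
     [(0, 0), (2, 1), (1, 0), (3, 1)],
     [(0, 1), (2, 0), (3, 0), (1, 0)],
     [(0, 0), (3, 1), (1, 1), (2, 1)],
     [(0, 1), (3, 1), (2, 0), (1, 1)]]"

lemma row_check_4: "row_check 4 rows4 cols4"
  by code_simp

definition rows6 :: "int list list" where
  "rows6 =
    [[3, 2, 5, 4, 0, 1],
     [0, 4, 5, 3, 1, 2],
     [4, 2, 0, 3, 5, 1],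
     [5, 2, 1, 4, 3, 0],
     [2, 3, 4, 1, 5, 0]]"

definition cols6 :: "(int \<times> bool) list list" where
  "cols6 = map (map (map_prod id (\<lambda>b. b = (1 :: int))))
    [[(0, 1), (1, 0), (4, 1), (5, 1), (3, 1), (2, 0)],
     [(0, 0), (1, 0), (2, 1), (3, 1), (4, 0), (5, 1)],
     [(0, 0), (3, 0), (4, 0), (2, 1), (1, 1), (5, 0)],
     [(0, 1), (3, 1), (1, 0), (5, 1), (2, 0), (4, 0)],
     [(0, 1), (2, 0), (5, 0), (3, 0), (1, 1), (4, 1)],
     [(0, 0), (2, 0), (3, 1), (5, 0), (4, 1), (1, 0)],
     [(0, 0), (5, 1), (4, 1), (3, 0), (2, 0), (1, 1)],
     [(0, 1), (5, 1), (1, 1), (2, 1), (4, 0), (3, 1)],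
     [(0, 0), (4, 1), (2, 1), (5, 0), (1, 1), (3, 0)],
     [(0, 1), (4, 0), (1, 0), (3, 0), (5, 0), (2, 1)]]"

lemma row_check_6: "row_check 6 rows6 cols6"
  by code_simp

section \<open>Cycle connectivity\<close>

lemma mp_packing:
  assumes "1 \<le> w" "2 \<le> l" "(w, l) \<notin> {(1, 4), (1, 6)}"
  shows "ham_packing (mp_V w l) mp_A (w * (l - 1))"
proof -
  \<comment> \<open>Blows up each vertex of the complete digraph to a part of size
    \<open>w\<close>.\<close>
  have from_complete: "ham_packing (mp_V w l) mp_A (w * (l - 1))"
    if "ham_packing {0..<int l} {(x, y). x \<noteq> y} (l - 1)" "even l \<or> odd w"
    using mp_blow_up[OF mp_packing_1[OF that(1)], of w] assms that(2) by (simp add: mult.commute)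
  show ?thesis
  proof (cases "even w")
    case True
    then obtain u where u: "w = 2 * u" by (rule evenE)
    \<comment> \<open>With parts of size 2 the number of vertices is even, so any factor
      \<open>u\<close> is allowed.\<close>
    have "ham_packing (mp_V (2 * u) l) mp_A (2 * (l - 1) * u)"
      using assms u by (intro mp_blow_up mp_packing_2) auto
    then show ?thesis by (simp add: u mult_ac)
  next
    case odd: False
    show ?thesis
    proof (cases "odd l")
      case True
      then have "3 \<le> l" using assms(2) by (cases "l = 2") auto
      then show ?thesis using from_complete complete_packing_odd True odd by blast
    next
      case False
      have "l = 2 \<or> l = 4 \<or> l = 6 \<or> 8 \<le> l" using False assms(2) by presburger
      then consider "l = 2" | "l = 4 \<or> l = 6" | "8 \<le> l" by blast
      then show ?thesis
      proof cases
        case 1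
        have "{0..<int l} = set [0, 1]" using 1 by auto
        moreover have "ham_cycle (set [0, 1]) (cycle_arcs [0, 1 :: int])"
          by (rule ham_cycle_cycle_arcs) auto
        ultimately have "ham_packing {0..<int l} {(x, y). x \<noteq> y} 1"
          by (intro ham_packingI[of "{0 :: nat}" 1 _ "\<lambda>_. cycle_arcs [0, 1]"])
            (simp_all add: cycle_arcs_Cons)
        then show ?thesis using from_complete 1 by simp
      next
        case 2
        \<comment> \<open>The excluded pairs leave only odd \<open>w\<close> from 3 on, as the row
          construction requires.\<close>
        then have "w \<noteq> 1" using assms(3) by auto
        then have w: "odd w" "3 \<le> w" using odd assms(1) by (auto elim!: oddE)
        have "row_system 4 w rows4 cols4" "row_system 6 w rows6 cols6"
          using row_check_4 row_check_6 w by (simp_all add: row_system_def)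
        then show ?thesis using 2 row_system.packing by blast
      next
        case 3
        then show ?thesis using from_complete complete_packing_even False by blast
      qed
    qed
  qed
qed

section \<open>From packings to connectivity numbers\<close>

lemma ham_cycle_in_unique:
  assumes "ham_cycle V C" "(x, y) \<in> C" "(x', y) \<in> C"
  shows "x = x'"
proof -
  obtain g N where g: "N \<ge> 2" "inj_on g {..<N}" "g N = g 0" "g ` {..<N} = V"
    "C = (\<lambda>t. (g t, g (Suc t))) ` {..<N}"
    by (rule ham_cycleE[OF assms(1)])
  obtain s t where st: "s < N" "t < N" "x = g s" "x' = g t" "g (Suc s) = g (Suc t)"
    using assms(2,3) g(5) by auto
  have *: "g (Suc r) = g (if Suc r = N then 0 else Suc r)" for r
    using g(3) by simp
  have "(if Suc s = N then 0 else Suc s) = (if Suc t = N then 0 else Suc t)"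
    by (rule inj_onD[OF g(2)]) (use st g(1) * in auto)
  then show ?thesis using st(3,4) by (auto split: if_splits)
qed

lemma S_cycle_ham: "is_S_cycle V A S c \<Longrightarrow> ham_cycle (set c) (cycle_arcs c) \<and> cycle_arcs c \<subseteq> A \<and> S \<subseteq> set c"
  by (auto simp: is_S_cycle_def is_dcycle_def ham_cycle_def)

definition S_cycle_family :: "'a set \<Rightarrow> ('a \<times> 'a) set \<Rightarrow> 'a set \<Rightarrow> 'a list list \<Rightarrow> bool" where
  "S_cycle_family V A S cs \<longleftrightarrow> (\<forall>c\<in>set cs. is_S_cycle V A S c) \<and>
     (\<forall>i j. i < length cs \<and> j < length cs \<and> i \<noteq> j \<longrightarrow> cycle_arcs (cs ! i) \<inter> cycle_arcs (cs ! j) = {})"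

lemma lambda_S_family: "lambda_S V A S = Max {length cs | cs. S_cycle_family V A S cs}"
  by (simp add: lambda_S_def S_cycle_family_def)

lemma S_cycle_family_length:
  assumes "S_cycle_family V A S cs" "v \<in> S" "finite (A `` {v})"
  shows "length cs \<le> card (A `` {v})"
proof -
  have "\<exists>y. (v, y) \<in> cycle_arcs (cs ! i)" if "i < length cs" for i
    using assms(1,2) that S_cycle_ham ham_cycle_out unfolding S_cycle_family_def
    by (metis nth_mem subsetD)
  then obtain y where y: "\<And>i. i < length cs \<Longrightarrow> (v, y i) \<in> cycle_arcs (cs ! i)"
    by metis
  have "inj_on y {..<length cs}"
  proof (rule inj_onI, rule ccontr)
    fix i j assume ij: "i \<in> {..<length cs}" "j \<in> {..<length cs}" "y i = y j" "i \<noteq> j"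
    then have "cycle_arcs (cs ! i) \<inter> cycle_arcs (cs ! j) = {}"
      using assms(1) by (simp add: S_cycle_family_def)
    then show False using y[of i] y[of j] ij by auto
  qed
  moreover have "y i \<in> A `` {v}" if "i < length cs" for i
  proof -
    have "cycle_arcs (cs ! i) \<subseteq> A"
      using assms(1) that S_cycle_ham unfolding S_cycle_family_def by (metis nth_mem)
    then show ?thesis using y[OF that] by blast
  qed
  then have "y ` {..<length cs} \<subseteq> A `` {v}" by blast
  ultimately show ?thesis
    using card_inj_on_le[of y "{..<length cs}" "A `` {v}"] assms(3) by simp
qed

lemma S_cycle_family_Nil: "S_cycle_family V A S []"
  by (simp add: S_cycle_family_def)

text \<open>\<open>Max\<close> is meaningful only on finite sets; the degree bound at a vertex of
  \<open>S\<close> provides finiteness.\<close>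

lemma finite_family_lengths:
  assumes "v \<in> S" "finite (A `` {v})"
  shows "finite {length cs | cs. S_cycle_family V A S cs}"
  by (rule finite_subset[of _ "{..card (A `` {v})}"])
    (use S_cycle_family_length[OF _ assms] in auto)

lemma lambda_S_le:
  assumes "v \<in> S" "finite (A `` {v})"
  shows "lambda_S V A S \<le> card (A `` {v})"
  unfolding lambda_S_family
proof (rule Max.boundedI[OF finite_family_lengths[OF assms]])
  show "{length cs | cs. S_cycle_family V A S cs} \<noteq> {}"
    using S_cycle_family_Nil by blast
qed (use S_cycle_family_length[OF _ assms] in auto)

text \<open>Cycles Hamiltonian on some \<open>W\<close> containing \<open>S\<close> are
  \<open>S\<close>-cycles; for unbalanced bipartite digraphs \<open>W\<close> is a proper part of
  \<open>V\<close>.\<close>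

lemma lambda_S_ge:
  assumes "ham_packing W A m" "S \<subseteq> W" "W \<subseteq> V" "v \<in> S" "finite (A `` {v})"
  shows "m \<le> lambda_S V A S"
proof -
  obtain F where F: "finite F" "card F = m" "\<forall>C\<in>F. ham_cycle W C \<and> C \<subseteq> A" "pairwise disjnt F"
    using assms(1) unfolding ham_packing_def by blast
  have "\<forall>C\<in>F. \<exists>xs. length xs \<ge> 2 \<and> distinct xs \<and> set xs = W \<and> C = cycle_arcs xs"
    using F(3) unfolding ham_cycle_def by blast
  then obtain h where h: "\<And>C. C \<in> F \<Longrightarrow> length (h C) \<ge> 2 \<and> distinct (h C) \<and> set (h C) = W \<and> C = cycle_arcs (h C)"
    by metis
  obtain Cs where Cs: "set Cs = F" "distinct Cs"
    using finite_distinct_list[OF F(1)] by blast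
  have arcs: "cycle_arcs (h (Cs ! i)) = Cs ! i" if "i < length Cs" for i
    using h[of "Cs ! i"] that Cs(1) by auto
  have "S_cycle_family V A S (map h Cs)"
    unfolding S_cycle_family_def
  proof (intro conjI ballI allI impI)
    fix c assume "c \<in> set (map h Cs)"
    then obtain C where "C \<in> F" "c = h C" using Cs(1) by auto
    then show "is_S_cycle V A S c"
      using h[of C] F(3) assms(2,3) by (auto simp: is_S_cycle_def is_dcycle_def)
  next
    fix i j assume ij: "i < length (map h Cs) \<and> j < length (map h Cs) \<and> i \<noteq> j"
    then have "Cs ! i \<noteq> Cs ! j" "Cs ! i \<in> F" "Cs ! j \<in> F"
      using Cs by (auto simp: nth_eq_iff_index_eq)
    then have "Cs ! i \<inter> Cs ! j = {}"
      using F(4) by (simp add: pairwise_def disjnt_def)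
    then show "cycle_arcs (map h Cs ! i) \<inter> cycle_arcs (map h Cs ! j) = {}"
      using arcs ij by simp
  qed
  moreover have "length (map h Cs) = m"
    using Cs F(2) by (simp add: distinct_card[symmetric])
  ultimately have "m \<in> {length cs | cs. S_cycle_family V A S cs}" by blast
  then show ?thesis
    unfolding lambda_S_family by (rule Max_ge[OF finite_family_lengths[OF assms(4,5)]])
qed

lemma lambda_k_eqI:
  assumes "finite V" "\<And>S. S \<subseteq> V \<Longrightarrow> card S = k \<Longrightarrow> m \<le> lambda_S V A S"
    and "S0 \<subseteq> V" "card S0 = k" "lambda_S V A S0 \<le> m"
  shows "lambda_k V A k = m"
  unfolding lambda_k_def
proof (rule Min_eqI)
  show "finite {lambda_S V A S | S. S \<subseteq> V \<and> card S = k}"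
    using assms(1) by (auto intro: finite_subset[of _ "lambda_S V A ` Pow V"])
  have "lambda_S V A S0 = m"
    using assms(2)[OF assms(3,4)] assms(5) by simp
  then show "m \<in> {lambda_S V A S | S. S \<subseteq> V \<and> card S = k}"
    using assms(3,4) by blast
qed (use assms(2) in blast)

lemma Kmp_packing:
  assumes "1 \<le> w" "2 \<le> l" "(w, l) \<notin> {(1, 4), (1, 6)}"
  shows "ham_packing (Kmp_V w l) (Kmp_A w l) (w * (l - 1))"
proof (rule ham_packing_map[OF mp_packing[OF assms], of "\<lambda>(p, a). (nat a, nat p)"])
  show "inj_on (\<lambda>(p, a). (nat a, nat p)) (mp_V w l)"
    by (auto simp: inj_on_def mp_V_def)
  show "(\<lambda>(p, a). (nat a, nat p)) ` mp_V w l = Kmp_V w l"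
  proof (intro equalityI subsetI)
    fix x assume "x \<in> Kmp_V w l"
    then have "x = (\<lambda>(p, a). (nat a, nat p)) (int (snd x), int (fst x))" "(int (snd x), int (fst x)) \<in> mp_V w l"
      by (auto simp: Kmp_V_def mp_V_def)
    then show "x \<in> (\<lambda>(p, a). (nat a, nat p)) ` mp_V w l" by (rule image_eqI)
  qed (auto simp: Kmp_V_def mp_V_def)
qed (auto simp: Kmp_A_def Kmp_V_def mp_V_def mp_A_def)

lemma lambda_k_Kmp:
  assumes "1 \<le> w" "1 \<le> l" "(w, l) \<notin> {(1, 4), (1, 6)}" "2 \<le> k" "k \<le> w * l"
  shows "lambda_k (Kmp_V w l) (Kmp_A w l) k = w * (l - 1)"
proof -
  have fin: "finite (Kmp_V w l)" by (simp add: Kmp_V_def)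
  have deg: "finite (Kmp_A w l `` {v})" "card (Kmp_A w l `` {v}) = w * (l - 1)" if "v \<in> Kmp_V w l" for v
  proof -
    have eq: "Kmp_A w l `` {v} = {0..<w} \<times> ({0..<l} - {snd v})"
      using that by (auto simp: Kmp_A_def Kmp_V_def)
    have "snd v \<in> {0..<l}" using that by (auto simp: Kmp_V_def)
    then show "finite (Kmp_A w l `` {v})" "card (Kmp_A w l `` {v}) = w * (l - 1)"
      unfolding eq by (simp_all add: card_cartesian_product)
  qed
  have "card (Kmp_V w l) = w * l" by (simp add: Kmp_V_def card_cartesian_product)
  then obtain S0 where S0: "S0 \<subseteq> Kmp_V w l" "card S0 = k"
    using obtain_subset_with_card_n[of k "Kmp_V w l"] assms(5) by metis
  show ?thesis
  proof (rule lambda_k_eqI[OF fin _ S0])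
    have "S0 \<noteq> {}" using S0(2) assms(4) by auto
    then obtain v where "v \<in> S0" by blast
    then show "lambda_S (Kmp_V w l) (Kmp_A w l) S0 \<le> w * (l - 1)"
      using lambda_S_le[of v S0] deg[of v] S0(1) by (metis subsetD)
    fix S assume S: "S \<subseteq> Kmp_V w l" "card S = k"
    then have "S \<noteq> {}" using assms(4) by auto
    then obtain v where "v \<in> S" by blast
    then have "v \<in> Kmp_V w l" using S(1) by blast
    show "w * (l - 1) \<le> lambda_S (Kmp_V w l) (Kmp_A w l) S"
    \<comment> \<open>With a single part there are no arcs and the bound is 0.\<close>
    proof (cases "l = 1")
      case False
      then have "2 \<le> l" using assms(2) by simp
      from Kmp_packing[OF assms(1) this assms(3)] show ?thesis
        by (rule lambda_S_ge[OF _ S(1) order_refl \<open>v \<in> S\<close> deg(1)[OF \<open>v \<in> Kmp_V w l\<close>]])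
    qed simp
  qed
qed

section \<open>Complete bipartite digraphs\<close>

lemma Kbip_out: "j < z \<Longrightarrow> Kbip_A t z `` {Inr j} = Inl ` {0..<t}"
  by (auto simp: Kbip_A_def)

lemma Kbip_out_finite: "finite (Kbip_A t z `` {v})"
proof (rule finite_subset)
  show "Kbip_A t z `` {v} \<subseteq> Inl ` {0..<t} \<union> Inr ` {0..<z}"
    by (auto simp: Kbip_A_def)
qed simp

text \<open>Restricting the right side to \<open>t\<close> vertices leaves the multipartite digraph
  with two parts of size \<open>t\<close>.\<close>

lemma Kbip_packing:
  assumes "1 \<le> t" "Y \<subseteq> {0..<z}" "card Y = t"
  shows "ham_packing (Inl ` {0..<t} \<union> Inr ` Y) (Kbip_A t z) t"
proof -
  have fin: "finite Y" using assms(2) finite_subset by blast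
  obtain e where e: "bij_betw e {0..<t} Y"
    using ex_bij_betw_nat_finite[OF fin] assms(3) by auto
  let ?f = "\<lambda>(p, a). if p = 0 then Inl (nat a) else Inr (e (nat a)) :: nat + nat"
  have eY: "a \<in> Y" if "a = e i" "i < t" for a i
    using that e by (auto simp: bij_betw_def)
  have "ham_packing (mp_V t 2) mp_A (t * (2 - 1))"
    using assms(1) by (intro mp_packing) auto
  then have "ham_packing (Inl ` {0..<t} \<union> Inr ` Y) (Kbip_A t z) (t * (2 - 1))"
  proof (rule ham_packing_map[where f = ?f])
    have inj: "inj_on e {0..<t}" using e by (rule bij_betw_imp_inj_on)
    show "inj_on ?f (mp_V t 2)"
    proof (rule inj_onI)
      fix x y assume xy: "x \<in> mp_V t 2" "y \<in> mp_V t 2" "?f x = ?f y"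
      obtain p a q b where x: "x = (p, a)" "y = (q, b)" by (metis surj_pair)
      have r: "0 \<le> a" "a < int t" "0 \<le> b" "b < int t" "p = 0 \<or> p = 1" "q = 0 \<or> q = 1"
        using xy(1,2) x by (auto simp: mp_V_def)
      show "x = y"
      proof (cases "p = 0")
        case True
        then show ?thesis using xy(3) x r by (auto split: if_splits)
      next
        case False
        then have "q \<noteq> 0" "e (nat a) = e (nat b)" using xy(3) x by (auto split: if_splits)
        moreover have "nat a \<in> {0..<t}" "nat b \<in> {0..<t}" using r by auto
        ultimately have "nat a = nat b" using inj_onD[OF inj] by blast
        then show ?thesis using x r False \<open>q \<noteq> 0\<close> by auto
      qed
    qed
    show "?f ` mp_V t 2 = Inl ` {0..<t} \<union> Inr ` Y"
    proof (intro equalityI subsetI)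
      fix y assume "y \<in> ?f ` mp_V t 2"
      then obtain x where x: "x \<in> mp_V t 2" "y = ?f x" by blast
      obtain p a where "x = (p, a)" by (cases x)
      then have "y = ?f (p, a)" "0 \<le> a" "a < int t"
        using x by (simp_all add: mp_V_def)
      then show "y \<in> Inl ` {0..<t} \<union> Inr ` Y"
        using eY[OF refl, of "nat a"] by (cases "p = 0") auto
    next
      fix y assume "y \<in> Inl ` {0..<t} \<union> Inr ` Y"
      then consider i where "i < t" "y = Inl i" | i where "i < t" "y = Inr (e i)"
        using e by (auto simp: bij_betw_def)
      then show "y \<in> ?f ` mp_V t 2"
      proof cases
        case 1
        then show ?thesis by (intro image_eqI[of _ _ "(0, int i)"]) (auto simp: mp_V_def)
      next
        case 2
        then show ?thesis by (intro image_eqI[of _ _ "(1, int i)"]) (auto simp: mp_V_def)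
      qed
    qed
    fix x y assume xy: "(x, y) \<in> mp_A" "x \<in> mp_V t 2" "y \<in> mp_V t 2"
    obtain p a q b where x: "x = (p, a)" "y = (q, b)" by (metis surj_pair)
    have r: "0 \<le> a" "a < int t" "0 \<le> b" "b < int t" "p = 0 \<and> q = 1 \<or> p = 1 \<and> q = 0"
      using xy x by (auto simp: mp_V_def mp_A_def)
    then have "nat a < t" "nat b < t" by auto
    then have "e (nat a) < z" "e (nat b) < z"
      using eY[OF refl] assms(2) by (meson atLeastLessThan_iff subsetD)+
    then show "(?f x, ?f y) \<in> Kbip_A t z"
      using r x by (auto simp: Kbip_A_def)
  qed
  then show ?thesis by simp
qed

text \<open>A set of at most \<open>t\<close> vertices meets the right side in at most
  \<open>t\<close> of them, so it lies in a balanced subdigraph with \<open>t\<close> vertices on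
  each side.\<close>

lemma lambda_k_Kbip_low:
  assumes "t < z" "2 \<le> k" "k \<le> t"
  shows "lambda_k (Kbip_V t z) (Kbip_A t z) k = t"
proof -
  have fin: "finite (Kbip_V t z)" by (simp add: Kbip_V_def)
  have card: "card (Kbip_V t z) = t + z"
    unfolding Kbip_V_def by (subst card_Un_disjoint) (auto simp: card_image)
  \<comment> \<open>Vertices on the right have out-degree \<open>t\<close>, those on the left
    \<open>z > t\<close>, so the set for the upper bound is made to contain one on the
    right.\<close>
  obtain S0 where S0: "{Inr 0} \<subseteq> S0" "S0 \<subseteq> Kbip_V t z" "card S0 = k"
    using exists_subset_between[of "{Inr 0}" k "Kbip_V t z"] assms fin card
    by (auto simp: Kbip_V_def)
  show ?thesis
  proof (rule lambda_k_eqI[OF fin _ S0(2,3)])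
    show "lambda_S (Kbip_V t z) (Kbip_A t z) S0 \<le> t"
      using lambda_S_le[of "Inr 0" S0 "Kbip_A t z" "Kbip_V t z"] S0(1) assms(1) Kbip_out_finite[of t z "Inr 0"]
      by (simp add: Kbip_out card_image)
    fix S assume S: "S \<subseteq> Kbip_V t z" "card S = k"
    then have "S \<noteq> {}" using assms(2) by auto
    then obtain v where v: "v \<in> S" by blast
    define Y0 where "Y0 = {j. Inr j \<in> S}"
    have "finite S" using S(1) fin finite_subset by blast
    then have "card (Inr ` Y0 :: (nat + nat) set) \<le> card S"
      by (intro card_mono) (auto simp: Y0_def)
    then have "card Y0 \<le> t" using S(2) assms(3) by (simp add: card_image)
    moreover have "Y0 \<subseteq> {0..<z}" using S(1) by (auto simp: Y0_def Kbip_V_def)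
    ultimately obtain Y where Y: "Y0 \<subseteq> Y" "Y \<subseteq> {0..<z}" "card Y = t"
      using exists_subset_between[of Y0 t "{0..<z}"] assms(1) by auto
    let ?W = "Inl ` {0..<t} \<union> Inr ` Y"
    have SW: "S \<subseteq> ?W"
    proof
      fix x assume "x \<in> S"
      then show "x \<in> ?W" using S(1) Y(1) by (cases x) (auto simp: Kbip_V_def Y0_def)
    qed
    have WV: "?W \<subseteq> Kbip_V t z" using Y(2) by (auto simp: Kbip_V_def)
    have "1 \<le> t" using assms by simp
    from Kbip_packing[OF this Y(2,3)] show "t \<le> lambda_S (Kbip_V t z) (Kbip_A t z) S"
      by (rule lambda_S_ge[OF _ SW WV v Kbip_out_finite])
  qed
qed

text \<open>The successors of the right-hand vertices are distinct left-hand vertices.\<close>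

lemma Kbip_cycle_right_card:
  assumes "ham_cycle V C" "C \<subseteq> Kbip_A t z"
  shows "card {j. Inr j \<in> V} \<le> t"
proof -
  have "\<forall>j\<in>{j. Inr j \<in> V}. \<exists>y. (Inr j, y) \<in> C"
    using ham_cycle_out[OF assms(1)] by blast
  then obtain f where f: "\<And>j. Inr j \<in> V \<Longrightarrow> (Inr j, f j) \<in> C"
    unfolding bchoice_iff by blast
  have "inj_on f {j. Inr j \<in> V}"
  proof (rule inj_onI)
    fix i j assume "i \<in> {j. Inr j \<in> V}" "j \<in> {j. Inr j \<in> V}" "f i = f j"
    then show "i = j"
      using ham_cycle_in_unique[OF assms(1) f[of i], of "Inr j"] f[of j] by auto
  qed
  moreover have "f ` {j. Inr j \<in> V} \<subseteq> Inl ` {0..<t}"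
    using f assms(2) by (fastforce simp: Kbip_A_def)
  ultimately have "card {j. Inr j \<in> V} \<le> card (Inl ` {0..<t} :: (nat + nat) set)"
    by (intro card_inj_on_le) auto
  then show ?thesis by (simp add: card_image)
qed

lemma lambda_k_Kbip_high:
  assumes "t < z" "t + 1 \<le> k" "k \<le> t + z"
  shows "lambda_k (Kbip_V t z) (Kbip_A t z) k = 0"
proof -
  have fin: "finite (Kbip_V t z)" by (simp add: Kbip_V_def)
  have card: "card (Kbip_V t z) = t + z"
    unfolding Kbip_V_def by (subst card_Un_disjoint) (auto simp: card_image)
  have c1: "card (Inr ` {0..t} :: (nat + nat) set) = t + 1" by (simp add: card_image)
  have c2: "Inr ` {0..t} \<subseteq> Kbip_V t z" using assms(1) by (auto simp: Kbip_V_def)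
  \<comment> \<open>As \<open>k > t\<close>, the set can contain \<open>t + 1\<close> right-hand
    vertices, more than any cycle meets.\<close>
  obtain S0 where S0: "Inr ` {0..t} \<subseteq> S0" "S0 \<subseteq> Kbip_V t z" "card S0 = k"
    using exists_subset_between[OF _ _ c2 fin, of k] assms card c1 by auto
  have "cs = []" if fam: "S_cycle_family (Kbip_V t z) (Kbip_A t z) S0 cs" for cs
  proof (rule ccontr)
    assume "cs \<noteq> []"
    then have "hd cs \<in> set cs" by simp
    then obtain c where "is_S_cycle (Kbip_V t z) (Kbip_A t z) S0 c"
      using fam unfolding S_cycle_family_def by blast
    then have c: "ham_cycle (set c) (cycle_arcs c)" "cycle_arcs c \<subseteq> Kbip_A t z" "S0 \<subseteq> set c"
      using S_cycle_ham by blast+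
    have "finite {j. Inr j \<in> set c}"
      using finite_vimageI[of "set c" Inr] by (simp add: vimage_def)
    then have "card {0..t} \<le> card {j. Inr j \<in> set c}"
      using S0(1) c(3) by (intro card_mono) auto
    then show False using Kbip_cycle_right_card[OF c(1,2)] by simp
  qed
  \<comment> \<open>Only the empty family remains, so the maximum is taken over
    \<open>{0}\<close>.\<close>
  then have "{length cs | cs. S_cycle_family (Kbip_V t z) (Kbip_A t z) S0 cs} = {0}"
    using S_cycle_family_Nil by force
  then have "lambda_S (Kbip_V t z) (Kbip_A t z) S0 \<le> 0"
    by (simp add: lambda_S_family)
  then show ?thesis by (intro lambda_k_eqI[OF fin _ S0(2,3)]) auto
qed

theorem theorem3p4:
  shows "(\<forall>w l k. 1 \<le> w \<and> 1 \<le> l \<and> w * l \<ge> 2 \<and> (w, l) \<notin> {(1, 4), (1, 6)} \<and>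
            2 \<le> k \<and> k \<le> w * l \<longrightarrow>
            lambda_k (Kmp_V w l) (Kmp_A w l) k = w * (l - 1))
       \<and> (\<forall>t z k. 2 \<le> t \<and> t < z \<longrightarrow>
            (2 \<le> k \<and> k \<le> t \<longrightarrow> lambda_k (Kbip_V t z) (Kbip_A t z) k = t) \<and>
            (t + 1 \<le> k \<and> k \<le> t + z \<longrightarrow> lambda_k (Kbip_V t z) (Kbip_A t z) k = 0))"
  by (intro conjI allI impI; elim conjE;
      (rule lambda_k_Kmp lambda_k_Kbip_low lambda_k_Kbip_high; assumption))

end
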